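(* Let $p>3$ be a prime. Put $f(x)=x^p+x+1$ if $p\equiv 1\ (\mathrm{mod}\ 3)$, and $f(x)=(x^p+x+1)/(x^2+x+1)$ if $p\equiv 2\ (\mathrm{mod}\ 3)$ (a polynomial in $\mathbb{Q}[x]$). Let $\alpha$ be a zero of $f(x)$ and $F=\mathbb{Q}(\alpha)$. Then, in $K_2(F)$, $$1\neq c_p(\alpha)^3=c_p(\alpha^3)\in G_p(F).$$
   Context: $K_2(F)$ is the Milnor $K_2$-group of $F$ (written multiplicatively, generated by symbols $\{a,b\}$, $a,b\in F^*$). $\Phi_p(x)$ is the $p$-th cyclotomic polynomial; for $a\in F^*$ with $\Phi_p(a)\neq 0$, $c_p(a)=\{a,\Phi_p(a)\}\in K_2(F)$, and $G_p(F)=\{c_p(a)\mid a,\Phi_p(a)\in F^*\}$. *)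

theory Defs
  imports
    "HOL-Algebra.Algebra"
    "HOL-Algebra.Algebraic_Closure_Type"
    "HOL-Computational_Algebra.Computational_Algebra"
    "HOL-Number_Theory.Cong"
begin

section \<open>The Milnor group K2 of a field\<close>

text \<open>
  The group is presented by generators and relations: it is the free abelian group on the
  pairs of units, modulo bimultiplicativity and the Steinberg relation.
  The library's free abelian group consists of formal integer combinations, so the relators
  are written with plus and minus; products and powers in the quotient are the
  multiplicative ones of the monoid record.
\<close>

definition K2_relators :: "('a, 'm) ring_scheme \<Rightarrow> ('a \<times> 'a \<Rightarrow>\<^sub>0 int) set" where
  "K2_relators R =
     {frag_of (a \<otimes>\<^bsub>R\<^esub> a', b) - (frag_of (a, b) + frag_of (a', b)) | a a' b.
        a \<in> Units R \<and> a' \<in> Units R \<and> b \<in> Units R} \<union>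
     {frag_of (a, b \<otimes>\<^bsub>R\<^esub> b') - (frag_of (a, b) + frag_of (a, b')) | a b b'.
        a \<in> Units R \<and> b \<in> Units R \<and> b' \<in> Units R} \<union>
     {frag_of (a, \<one>\<^bsub>R\<^esub> \<ominus>\<^bsub>R\<^esub> a) | a. a \<in> Units R \<and> \<one>\<^bsub>R\<^esub> \<ominus>\<^bsub>R\<^esub> a \<in> Units R}"

definition K2_free :: "('a, 'm) ring_scheme \<Rightarrow> ('a \<times> 'a \<Rightarrow>\<^sub>0 int) monoid" where
  "K2_free R = free_Abelian_group (Units R \<times> Units R)"

definition K2 :: "('a, 'm) ring_scheme \<Rightarrow> ('a \<times> 'a \<Rightarrow>\<^sub>0 int) set monoid" where
  "K2 R = K2_free R Mod generate (K2_free R) (K2_relators R)"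

text \<open>The symbol of a and b; meaningful only if both are units.\<close>

definition K2_symbol :: "('a, 'm) ring_scheme \<Rightarrow> 'a \<Rightarrow> 'a \<Rightarrow> ('a \<times> 'a \<Rightarrow>\<^sub>0 int) set" where
  "K2_symbol R a b = generate (K2_free R) (K2_relators R) #>\<^bsub>K2_free R\<^esub> frag_of (a, b)"

section \<open>Cyclotomic polynomials and cyclotomic elements\<close>

text \<open>
  The recursion is the factorisation of X^n - 1 into the product of the d-th cyclotomic
  polynomials, d ranging over the divisors of n; the division is exact.
\<close>

function cyclotomic :: "nat \<Rightarrow> int poly" where
  "cyclotomic n =
     (Polynomial.monom 1 n - 1) div (\<Prod>d | d dvd n \<and> d < n. cyclotomic d)"
  by auto
termination by (relation "Wellfounded.measure id") auto

declare cyclotomic.simps [simp del]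

lemma cyclotomic_prime:
  assumes "Factorial_Ring.prime p"
  shows "cyclotomic p = (\<Sum>i<p. Polynomial.monom 1 i)"
proof -
  have 0: "{d::nat. d dvd Suc 0 \<and> d < Suc 0} = {}"
    by auto
  have 1: "cyclotomic (Suc 0) = [:-1, 1:]"
  proof -
    have "Polynomial.monom 1 (Suc 0) - 1 = ([:-1, 1:] :: int poly)"
      by (simp add: monom_Suc one_pCons)
    then show ?thesis
      by (subst cyclotomic.simps) (simp only: 0 prod.empty div_by_1)
  qed
  have 2: "{d. d dvd p \<and> d < p} = {Suc 0}"
    using assms by (auto simp: prime_nat_iff)
  have 3: "(Polynomial.monom 1 p :: int poly) - 1 = [:-1, 1:] * (\<Sum>i<p. Polynomial.monom 1 i)"
    using power_diff_1_eq[of "[:0, 1:] :: int poly" p]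
    by (simp add: monom_altdef one_pCons)
  have "cyclotomic p = (Polynomial.monom 1 p - 1) div [:-1, 1:]"
    by (subst cyclotomic.simps) (simp add: 1 2)
  then show ?thesis
    unfolding 3 by (subst (asm) nonzero_mult_div_cancel_left) simp_all
qed

definition cyclotomic_at :: "nat \<Rightarrow> 'a::field \<Rightarrow> 'a" where
  "cyclotomic_at n a = poly (map_poly of_int (cyclotomic n)) a"

text \<open>A subfield K of the type \<open>'a\<close>, as a ring in the sense of HOL-Algebra.\<close>

definition ring_on :: "'a::field set \<Rightarrow> 'a ring" where
  "ring_on K = ring_of_type_algebra\<lparr>carrier := K\<rparr>"

definition cyclotomic_elem :: "nat \<Rightarrow> 'a::field set \<Rightarrow> 'a \<Rightarrow> ('a \<times> 'a \<Rightarrow>\<^sub>0 int) set" where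
  "cyclotomic_elem n K a = K2_symbol (ring_on K) a (cyclotomic_at n a)"

definition cyclotomic_elems :: "nat \<Rightarrow> 'a::field set \<Rightarrow> ('a \<times> 'a \<Rightarrow>\<^sub>0 int) set set" where
  "cyclotomic_elems n K =
     {cyclotomic_elem n K a | a. a \<in> K \<and> a \<noteq> 0 \<and> cyclotomic_at n a \<noteq> 0}"

section \<open>Simple extensions of the rationals\<close>

definition rat_adjoin :: "'a::field_char_0 \<Rightarrow> 'a set" where
  "rat_adjoin \<alpha> = generate_field ring_of_type_algebra (insert \<alpha> \<rat>)"

lemma subfield_rat_adjoin: "subfield (rat_adjoin \<alpha>) ring_of_type_algebra"
proof -
  interpret field "ring_of_type_algebra :: 'a ring"
    by (rule field_from_type_algebra)
  show ?thesis
    unfolding rat_adjoin_def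
    by (rule generate_field_is_subfield) (simp add: ring_of_type_algebra_def)
qed

text \<open>The division by X^2 + X + 1 in the second case of the theorem is exact.\<close>

lemma quadratic_dvd_trinomial:
  assumes "[p = 2] (mod 3)"
  shows "[:1, 1, 1:] dvd (Polynomial.monom 1 p + [:1, 1:] :: rat poly)"
proof -
  define x :: "rat poly" where "x = [:0, 1:]"
  from assms have "p mod 3 = 2"
    by (simp add: cong_def)
  then obtain k where k: "p = 3 * k + 2"
    by (metis add.commute mod_mult_div_eq mult.commute)
  have "x ^ 3 - 1 dvd (x ^ 3) ^ k - 1"
    by (simp add: power_diff_1_eq)
  moreover have "x ^ 3 - 1 = (x\<^sup>2 + x + 1) * (x - 1)"
    by (simp add: algebra_simps power2_eq_square power3_eq_cube)
  ultimately have "x\<^sup>2 + x + 1 dvd (x ^ 3) ^ k - 1"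
    by (metis dvd_mult_left)
  then have "x\<^sup>2 + x + 1 dvd x\<^sup>2 * ((x ^ 3) ^ k - 1) + (x\<^sup>2 + x + 1)"
    by simp
  also have "x\<^sup>2 * ((x ^ 3) ^ k - 1) + (x\<^sup>2 + x + 1) = x ^ p + x + 1"
  proof -
    have "x ^ p = x\<^sup>2 * (x ^ 3) ^ k"
      by (simp only: k power_add power_mult mult.commute[of "x\<^sup>2"])
    then show ?thesis
      by (simp only:) (simp add: right_diff_distrib)
  qed
  finally show ?thesis
    by (simp add: x_def monom_altdef power2_eq_square one_pCons add.assoc)
qed

end

theory Submission
  imports Defs "HOL-Number_Theory.Pocklington"
begin

text \<open>
  Write \<open>T = X^p + X + 1\<close>; it vanishes at \<open>\<alpha>\<close>.  Since \<open>\<alpha>^p = - \<alpha> - 1\<close>, one has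
  \<open>\<Phi>\<^sub>p(\<alpha>) = (\<alpha> + 2) / (1 - \<alpha>)\<close>, and as \<open>(\<alpha> + 1)^3 + 1\<close> factors as
  \<open>(\<alpha> + 2) (\<alpha>\<^sup>2 + \<alpha> + 1)\<close>, also \<open>\<Phi>\<^sub>p(\<alpha>^3) = \<Phi>\<^sub>p(\<alpha>)\<close>, provided that
  \<open>\<alpha>\<close> is not a primitive cube root of unity.  Hence \<open>c\<^sub>p(\<alpha>^3) = {\<alpha>^3, \<Phi>\<^sub>p(\<alpha>)} = c\<^sub>p(\<alpha>)^3\<close>.

  That this element is nontrivial is detected by a tame symbol at a prime of \<open>F\<close> that divides
  \<open>\<alpha> + 2\<close>.  Let \<open>g\<close> be the minimal polynomial of \<open>\<alpha>\<close> over the integers.  The value \<open>g(-2)\<close>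
  divides \<open>T(-2) = -(2^p + 1)\<close>.  If a prime \<open>l \<noteq> 3\<close> divides \<open>g(-2)\<close>, then \<open>-2\<close> has order
  \<open>p\<close> modulo \<open>l\<close>, so \<open>l > p\<close>, and from this \<open>-2\<close> is a simple root of \<open>g\<close> modulo \<open>l\<close>.  Therefore
  localising \<open>\<int>[\<alpha>]\<close> at \<open>(l, \<alpha> + 2)\<close> gives a discrete valuation ring with uniformizer \<open>l\<close>, in which
  \<open>\<alpha> \<equiv> -2\<close> is a unit and \<open>\<alpha> + 2\<close> has valuation \<open>e\<close>, the multiplicity of \<open>l\<close> in \<open>g(-2)\<close>.
  The tame symbol sends \<open>c\<^sub>p(\<alpha>)\<close> to the residue of \<open>\<alpha>^e\<close>, that is to \<open>(-2)^e\<close>, and its cube is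
  nontrivial as soon as \<open>p\<close> does not divide \<open>e\<close>.

  It remains to find \<open>l\<close> with \<open>p\<close> not dividing \<open>e\<close>.  If there were none, then
  \<open>\<bar>g(-2)\<bar> = 3^a m^p\<close>, with \<open>a \<le> 1\<close> because \<open>9\<close> does not divide \<open>2^p + 1\<close>, and with \<open>m = 1\<close>
  because \<open>m\<close> is odd and \<open>3^p > 2^p + 1\<close>; so \<open>\<bar>g(-2)\<bar>\<close> would be at most \<open>3\<close>.  This contradicts
  \<open>factor_value_gt_3\<close>: by the arithmetic-geometric mean inequality every complex root \<open>z\<close> of \<open>T\<close>
  satisfies \<open>\<bar>z + 2\<bar>^6 \<ge> 27 \<bar>z\<bar>^(4p - 2)\<close>, and multiplying over the roots of \<open>g\<close>, whose
  product is \<open>\<plusminus>1\<close>, gives \<open>\<bar>g(-2)\<bar>^6 \<ge> 27^(deg g)\<close>; the remaining degrees 1 and 2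
  are settled by hand.
\<close>

section \<open>Local rings with a uniformizer and the squared tame symbol\<close>

text \<open>
  The local behaviour of a discrete valuation, stated inside an ambient field.  The last two axioms
  together say that \<open>\<pi>\<close> is a nonzero nonunit in the Jacobson radical.  The axioms allow elements divisible by all powers of
  \<open>\<pi>\<close>; the elements that do have a valuation are collected in the set \<open>valued\<close> below.
\<close>

locale local_ring_with_uniformizer =
  fixes R :: "'a::field set" and \<pi> :: 'a
  assumes one_mem: "1 \<in> R"
    and diff_mem: "x \<in> R \<Longrightarrow> y \<in> R \<Longrightarrow> x - y \<in> R"
    and mult_mem: "x \<in> R \<Longrightarrow> y \<in> R \<Longrightarrow> x * y \<in> R"
    and unif_mem: "\<pi> \<in> R"
    and inverse_unif_notin: "inverse \<pi> \<notin> R"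
    and inverse_principal_mem: "r \<in> R \<Longrightarrow> inverse (1 - \<pi> * r) \<in> R"
begin

definition U :: "'a set" where "U = {u. u \<noteq> 0 \<and> u \<in> R \<and> inverse u \<in> R}"

text \<open>
  The principal units, the kernel of reduction modulo \<open>\<pi>\<close> on the unit group.  Working modulo
  \<open>U1\<close> inside the ambient field replaces the multiplicative group of the residue field.
\<close>

definition U1 :: "'a set" where "U1 = (\<lambda>r. 1 - \<pi> * r) ` R"

definition valued :: "'a set" where "valued = {\<pi> powi n * u | n u. u \<in> U}"

definition val :: "'a \<Rightarrow> int" where "val x = (THE n. x * \<pi> powi (- n) \<in> U)"

definition unit_part :: "'a \<Rightarrow> 'a" where "unit_part x = x * \<pi> powi (- val x)"

text \<open>
  The tame symbol of \<open>a\<close> and \<open>b\<close> is the residue of \<open>(-1)^(v(a) v(b)) a^v(b) b^(-v(a))\<close>.  Squaring removes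
  the sign, and in terms of unit parts the powers of \<open>\<pi>\<close> cancel, which leaves a lift of the square
  to the unit group that is bimultiplicative on the nose.  An odd prime order survives squaring.
\<close>

definition tame_square :: "'a \<Rightarrow> 'a \<Rightarrow> 'a" where
  "tame_square a b = (unit_part a powi val b * unit_part b powi (- val a))\<^sup>2"

lemma zero_mem: "0 \<in> R"
  using diff_mem[OF one_mem one_mem] by simp

lemma minus_mem: "x \<in> R \<Longrightarrow> - x \<in> R"
  using diff_mem[OF zero_mem] by simp

lemma add_mem: "x \<in> R \<Longrightarrow> y \<in> R \<Longrightarrow> x + y \<in> R"
  using diff_mem[of x "- y"] minus_mem by simp

lemma power_mem: "x \<in> R \<Longrightarrow> x ^ n \<in> R"
  by (induction n) (auto intro: one_mem mult_mem)

lemma unif_nonzero: "\<pi> \<noteq> 0"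
  using inverse_unif_notin zero_mem by auto

lemma U_nonzero: "u \<in> U \<Longrightarrow> u \<noteq> 0"
  by (simp add: U_def)

lemma U_mem: "u \<in> U \<Longrightarrow> u \<in> R"
  by (simp add: U_def)

lemma U_one: "1 \<in> U"
  by (simp add: U_def one_mem)

lemma U_mult: "u \<in> U \<Longrightarrow> w \<in> U \<Longrightarrow> u * w \<in> U"
  by (simp add: U_def mult_mem)

lemma U_inverse: "u \<in> U \<Longrightarrow> inverse u \<in> U"
  by (simp add: U_def)

lemma U_minus: "u \<in> U \<Longrightarrow> - u \<in> U"
  by (simp add: U_def minus_mem)

lemma U1_subset_U: "u \<in> U1 \<Longrightarrow> u \<in> U"
proof -
  assume "u \<in> U1"
  then obtain r where r: "r \<in> R" "u = 1 - \<pi> * r"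
    by (auto simp: U1_def)
  have "1 - \<pi> * r \<noteq> 0"
  proof
    assume "1 - \<pi> * r = 0"
    then have "r = inverse \<pi>"
      by (metis eq_iff_diff_eq_0 inverse_unique)
    then show False
      using r inverse_unif_notin by simp
  qed
  then show ?thesis
    using r by (auto simp: U_def intro: diff_mem one_mem mult_mem unif_mem inverse_principal_mem)
qed

lemma U1_one: "1 \<in> U1"
  unfolding U1_def by (rule image_eqI[OF _ zero_mem]) simp

lemma U1_mult: "u \<in> U1 \<Longrightarrow> w \<in> U1 \<Longrightarrow> u * w \<in> U1"
proof -
  assume "u \<in> U1" "w \<in> U1"
  then obtain r s where "r \<in> R" "s \<in> R" and uw: "u = 1 - \<pi> * r" "w = 1 - \<pi> * s"
    by (auto simp: U1_def)
  then have "r + s - \<pi> * (r * s) \<in> R"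
    by (intro diff_mem add_mem mult_mem unif_mem)
  moreover have "u * w = 1 - \<pi> * (r + s - \<pi> * (r * s))"
    by (simp add: uw algebra_simps)
  ultimately show ?thesis
    by (auto simp: U1_def)
qed

lemma U1_inverse: "u \<in> U1 \<Longrightarrow> inverse u \<in> U1"
proof -
  assume u: "u \<in> U1"
  then obtain r where r: "r \<in> R" "u = 1 - \<pi> * r"
    by (auto simp: U1_def)
  have U: "u \<noteq> 0" "inverse u \<in> R"
    using U1_subset_U[OF u] by (auto simp: U_def)
  have "inverse u = (u + \<pi> * r) * inverse u"
    using r(2) by simp
  also have "\<dots> = 1 - \<pi> * (- (r * inverse u))"
    using U by (simp add: distrib_right mult.assoc)
  finally have "inverse u = 1 - \<pi> * (- (r * inverse u))" .
  moreover have "- (r * inverse u) \<in> R"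
    using r U by (intro minus_mem mult_mem)
  ultimately show ?thesis
    unfolding U1_def by blast
qed

lemma U_power_int: "u \<in> U \<Longrightarrow> u powi n \<in> U"
proof -
  assume u: "u \<in> U"
  have "w \<in> U \<Longrightarrow> w ^ k \<in> U" for w k
    by (induction k) (auto intro: U_one U_mult)
  then show ?thesis
    using u U_inverse[OF u] by (auto simp: power_int_def)
qed

lemma U1_power_int: "u \<in> U1 \<Longrightarrow> u powi n \<in> U1"
proof -
  assume u: "u \<in> U1"
  have "w \<in> U1 \<Longrightarrow> w ^ k \<in> U1" for w k
    by (induction k) (auto intro: U1_one U1_mult)
  then show ?thesis
    using u U1_inverse[OF u] by (auto simp: power_int_def)
qed

lemma unif_power_int_mem:
  assumes "0 < n"
  obtains r where "r \<in> R" "\<pi> powi n = \<pi> * r"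
proof -
  have "\<pi> powi n = \<pi> * \<pi> ^ (nat n - 1)"
    using assms by (simp add: power_int_def flip: power_Suc)
  then show ?thesis
    using that power_mem unif_mem by blast
qed

text \<open>
  Makes the valuation well defined: a unit that is a proper power of \<open>\<pi>\<close> would make \<open>\<pi>\<close> itself
  invertible.
\<close>

lemma unif_power_int_in_U:
  assumes "\<pi> powi n \<in> U"
  shows "n = 0"
proof (rule ccontr)
  assume n: "n \<noteq> 0"
  define m where "m = \<bar>n\<bar>"
  have m: "m > 0" "\<pi> powi m \<in> U"
    using assms n U_inverse[OF assms] by (auto simp: m_def abs_if power_int_minus)
  obtain r where r: "r \<in> R" "\<pi> powi m = \<pi> * r"
    using unif_power_int_mem m by blast
  have "inverse \<pi> = r * inverse (\<pi> powi m)"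
    unfolding r(2) using U_nonzero[OF m(2)] r(2) by (simp add: field_simps)
  moreover have "r * inverse (\<pi> powi m) \<in> R"
    using r(1) m(2) by (intro mult_mem) (auto simp: U_def)
  ultimately show False
    using inverse_unif_notin by simp
qed

lemma val_eqI:
  assumes "x = \<pi> powi n * u" "u \<in> U"
  shows "val x = n" "unit_part x = u"
proof -
  have *: "\<pi> powi n * u * \<pi> powi (- m) = \<pi> powi (n - m) * u" for m
    using unif_nonzero by (simp add: power_int_diff power_int_minus field_simps)
  have "m = n" if "x * \<pi> powi (- m) \<in> U" for m
  proof -
    have "\<pi> powi (n - m) * u * inverse u \<in> U"
      using U_mult[OF that U_inverse[OF assms(2)]] by (simp only: assms(1) *)
    then show ?thesis
      using unif_power_int_in_U[of "n - m"] U_nonzero[OF assms(2)] by (simp add: mult.assoc)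
  qed
  moreover have "x * \<pi> powi (- n) \<in> U"
    using assms by (simp add: *)
  ultimately show "val x = n"
    unfolding val_def by blast
  then show "unit_part x = u"
    by (simp add: unit_part_def assms(1) *)
qed

lemma valued_decomp:
  assumes "x \<in> valued"
  shows "x = \<pi> powi val x * unit_part x" "unit_part x \<in> U" "x \<noteq> 0"
proof -
  obtain n u where nu: "x = \<pi> powi n * u" "u \<in> U"
    using assms by (auto simp: valued_def)
  show "x = \<pi> powi val x * unit_part x" "unit_part x \<in> U" "x \<noteq> 0"
    using val_eqI[OF nu] nu unif_nonzero U_nonzero[OF nu(2)] by auto
qed

lemma U_subset_valued: "u \<in> U \<Longrightarrow> u \<in> valued"
  unfolding valued_def by (rule CollectI, rule exI[of _ 0], rule exI[of _ u]) simp

lemma unif_valued: "\<pi> \<in> valued"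
  unfolding valued_def by (intro CollectI exI[of _ 1]) (simp add: U_one)

lemma valued_mult:
  assumes "x \<in> valued" "y \<in> valued"
  shows "x * y \<in> valued"
proof -
  obtain m u n w where "x = \<pi> powi m * u" "y = \<pi> powi n * w" "u \<in> U" "w \<in> U"
    using assms by (auto simp: valued_def)
  then have "x * y = \<pi> powi (m + n) * (u * w)" "u * w \<in> U"
    using unif_nonzero by (simp_all add: power_int_add U_mult)
  then show ?thesis
    unfolding valued_def by blast
qed

lemma valued_inverse:
  assumes "x \<in> valued"
  shows "inverse x \<in> valued"
proof -
  obtain m u where "x = \<pi> powi m * u" "u \<in> U"
    using assms by (auto simp: valued_def)
  then have "inverse x = \<pi> powi (- m) * inverse u" "inverse u \<in> U"
    by (simp_all add: power_int_minus U_inverse)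
  then show ?thesis
    unfolding valued_def by blast
qed

lemma val_mult:
  assumes "x \<in> valued" "y \<in> valued"
  shows "val (x * y) = val x + val y" "unit_part (x * y) = unit_part x * unit_part y"
proof -
  have "x * y = \<pi> powi (val x + val y) * (unit_part x * unit_part y)"
  proof -
    have "x * y = (\<pi> powi val x * unit_part x) * (\<pi> powi val y * unit_part y)"
      by (rule arg_cong2[where f = "(*)"]) (rule valued_decomp(1), fact)+
    then show ?thesis
      using unif_nonzero by (simp add: power_int_add)
  qed
  from val_eqI[OF this U_mult]
  show "val (x * y) = val x + val y" "unit_part (x * y) = unit_part x * unit_part y"
    using valued_decomp assms by auto
qed

lemma tame_square_in_U:
  "a \<in> valued \<Longrightarrow> b \<in> valued \<Longrightarrow> tame_square a b \<in> U"
  unfolding tame_square_def power2_eq_square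
  by (intro U_mult U_power_int valued_decomp)

lemma tame_square_mult_left:
  assumes "a \<in> valued" "a' \<in> valued" "b \<in> valued"
  shows "tame_square (a * a') b = tame_square a b * tame_square a' b"
  using valued_decomp(2)[THEN U_nonzero] assms
  by (simp add: tame_square_def val_mult power_int_mult_distrib power_mult_distrib power_int_diff
      power_int_minus field_simps)

lemma tame_square_mult_right:
  assumes "a \<in> valued" "b \<in> valued" "b' \<in> valued"
  shows "tame_square a (b * b') = tame_square a b * tame_square a b'"
  using valued_decomp(2)[THEN U_nonzero] assms
  by (simp add: tame_square_def val_mult power_int_mult_distrib power_mult_distrib power_int_add
      field_simps)

text \<open>
  If \<open>a\<close> has positive valuation then \<open>1 - a\<close> is a principal unit; if \<open>a\<close> is a unit and \<open>1 - a\<close> is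
  not, then \<open>a\<close> is a principal unit; if both are units the symbol is trivial; and if \<open>a\<close> has a
  pole, then \<open>1 - a\<close> has a pole of the same order whose leading unit is that of \<open>-a\<close>, up to a
  principal unit.
\<close>

lemma tame_square_steinberg:
  assumes a: "a \<in> valued" and b: "1 - a \<in> valued"
  shows "tame_square a (1 - a) \<in> U1"
proof -
  define n u m w where "n = val a" "u = unit_part a" "m = val (1 - a)" "w = unit_part (1 - a)"
  note defs = this
  have eqs: "a = \<pi> powi n * u" "1 - a = \<pi> powi m * w" and units: "u \<in> U" "w \<in> U"
    using valued_decomp[OF a] valued_decomp[OF b] by (simp_all add: defs)
  have uw: "u \<noteq> 0" "w \<noteq> 0"
    using units U_nonzero by auto
  have tame: "tame_square a (1 - a) = (u powi m * w powi (- n))\<^sup>2"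
    by (simp add: tame_square_def defs)
  consider "n > 0" | "n = 0" "m > 0" | "n = 0" "m = 0" | "n = 0" "m < 0" | "n < 0"
    by linarith
  then show ?thesis
  proof cases
    case 1
    obtain r where r: "r \<in> R" "\<pi> powi n = \<pi> * r"
      using unif_power_int_mem 1 by blast
    have "1 - a = 1 - \<pi> * (r * u)"
      by (simp add: eqs(1) r)
    then have "1 - a \<in> U1"
      unfolding U1_def using r(1) U_mem[OF units(1)] mult_mem by blast
    then have "m = 0" "w \<in> U1"
      using val_eqI[of "1 - a" 0 "1 - a"] U1_subset_U by (auto simp: defs)
    then show ?thesis
      unfolding tame by (auto simp: power2_eq_square intro!: U1_mult U1_power_int)
  next
    case 2
    obtain r where r: "r \<in> R" "\<pi> powi m = \<pi> * r"
      using unif_power_int_mem 2 by blast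
    have "u = 1 - \<pi> * (r * w)"
      using eqs 2 r by (simp add: algebra_simps)
    then have "u \<in> U1"
      unfolding U1_def using r(1) U_mem[OF units(2)] mult_mem by blast
    then show ?thesis
      unfolding tame using 2 by (auto simp: power2_eq_square intro!: U1_mult U1_power_int)
  next
    case 3
    then show ?thesis
      unfolding tame by (simp add: U1_one)
  next
    \<comment> \<open>This case does not occur: if \<open>a\<close> lies in \<open>R\<close>, then so does \<open>1 - a\<close>.\<close>
    case 4
    obtain r where r: "r \<in> R" "\<pi> powi (- m) = \<pi> * r"
      using unif_power_int_mem[of "- m"] 4 by auto
    have "\<pi> powi (- m) * (1 - a) = w"
      using eqs(2) unif_nonzero by (simp add: power_int_minus)
    then have "w = \<pi> * (r * (1 - u))"
      using eqs(1) 4 r by (simp add: mult.assoc)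
    then have "inverse \<pi> = (r * (1 - u)) * inverse w"
      using uw unif_nonzero by (simp add: field_simps)
    moreover have "(r * (1 - u)) * inverse w \<in> R"
      using r units by (intro mult_mem diff_mem one_mem) (auto simp: U_def)
    ultimately show ?thesis
      using inverse_unif_notin by simp
  next
    case 5
    obtain r where r: "r \<in> R" "\<pi> powi (- n) = \<pi> * r"
      using unif_power_int_mem[of "- n"] 5 by auto
    \<comment> \<open>The principal unit by which the leading units of \<open>- a\<close> and \<open>1 - a\<close> differ.\<close>
    define z where "z = 1 - \<pi> * (r * inverse u)"
    have z: "z \<in> U1"
      unfolding U1_def z_def using r units by (auto simp: U_def intro: mult_mem)
    have "1 - a = \<pi> powi n * (\<pi> powi (- n) - u)"
      using unif_nonzero by (simp add: eqs(1) right_diff_distrib flip: power_int_add)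
    also have "\<pi> powi (- n) - u = - (u * z)"
      using uw by (simp add: r(2) z_def field_simps)
    finally have "m = n" "w = - (u * z)"
      using val_eqI[of "1 - a" n "- (u * z)"] units z U1_subset_U by (auto simp: defs U_minus U_mult)
    moreover have "z \<noteq> 0"
      using z U1_subset_U U_nonzero by blast
    ultimately have "u * inverse w = - inverse z"
      using uw by (simp add: field_simps)
    have "tame_square a (1 - a) = (u powi n * inverse w powi n)\<^sup>2"
      by (simp add: tame \<open>m = n\<close> power_int_minus flip: power_int_inverse)
    also have "\<dots> = ((u * inverse w)\<^sup>2) powi n"
      by (simp add: power2_eq_square power_int_mult_distrib)
    also have "\<dots> = ((inverse z)\<^sup>2) powi n"
      by (simp add: \<open>u * inverse w = - inverse z\<close>)
    finally have "tame_square a (1 - a) = ((inverse z)\<^sup>2) powi n" .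
    moreover have "((inverse z)\<^sup>2) powi n \<in> U1"
      unfolding power2_eq_square using z by (intro U1_power_int U1_mult U1_inverse)
    ultimately show ?thesis
      by simp
  qed
qed

end

section \<open>Detecting symbols in K2\<close>

lemma K2_relators_subset:
  assumes "ring R"
  shows "K2_relators R \<subseteq> carrier (K2_free R)"
proof -
  interpret ring R by fact
  have "Poly_Mapping.keys (frag_of x - (frag_of y + frag_of z)) \<subseteq> {x, y, z}" for x y z :: "'a \<times> 'a"
    using keys_diff[of "frag_of x" "frag_of y + frag_of z"] keys_add[of "frag_of y" "frag_of z"]
    by auto
  then have "Poly_Mapping.keys (frag_of x - (frag_of y + frag_of z)) \<subseteq> Units R \<times> Units R"
    if "x \<in> Units R \<times> Units R" "y \<in> Units R \<times> Units R" "z \<in> Units R \<times> Units R" for x y z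
    using that by blast
  then show ?thesis
    unfolding K2_relators_def K2_free_def
    by (intro subsetI, elim UnE CollectE exE conjE; simp)
qed

lemma K2_relations_normal:
  assumes "ring R"
  shows "generate (K2_free R) (K2_relators R) \<lhd> K2_free R"
proof -
  interpret comm_group "K2_free R"
    unfolding K2_free_def by (rule abelian_free_Abelian_group)
  show ?thesis
    by (intro subgroup_imp_normal generate_is_subgroup K2_relators_subset assms)
qed

text \<open>
  Bimultiplicativity holds because the corresponding relator lies in the subgroup that is
  factored out.
\<close>

lemma K2_symbol_mult_left:
  assumes "ring R" "a \<in> Units R" "a' \<in> Units R" "b \<in> Units R"
  shows "K2_symbol R (a \<otimes>\<^bsub>R\<^esub> a') b = K2_symbol R a b \<otimes>\<^bsub>K2 R\<^esub> K2_symbol R a' b"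
proof -
  interpret ring R by fact
  interpret N: normal "generate (K2_free R) (K2_relators R)" "K2_free R"
    by (rule K2_relations_normal) fact
  let ?x = "frag_of (a, b)" and ?y = "frag_of (a', b)" and ?z = "frag_of (a \<otimes>\<^bsub>R\<^esub> a', b)"
  have mem: "?x \<in> carrier (K2_free R)" "?y \<in> carrier (K2_free R)"
    using assms by (simp_all add: K2_free_def)
  have "?z - (?x + ?y) \<in> generate (K2_free R) (K2_relators R)"
    using assms by (intro generate.incl) (auto simp: K2_relators_def)
  then have "(?z - (?x + ?y)) \<otimes>\<^bsub>K2_free R\<^esub> (?x \<otimes>\<^bsub>K2_free R\<^esub> ?y)
      \<in> generate (K2_free R) (K2_relators R) #>\<^bsub>K2_free R\<^esub> (?x \<otimes>\<^bsub>K2_free R\<^esub> ?y)"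
    by (auto simp: r_coset_def)
  then have "?z \<in> generate (K2_free R) (K2_relators R) #>\<^bsub>K2_free R\<^esub> (?x \<otimes>\<^bsub>K2_free R\<^esub> ?y)"
    by (simp add: K2_free_def)
  then have "K2_symbol R (a \<otimes>\<^bsub>R\<^esub> a') b
      = generate (K2_free R) (K2_relators R) #>\<^bsub>K2_free R\<^esub> (?x \<otimes>\<^bsub>K2_free R\<^esub> ?y)"
    unfolding K2_symbol_def using mem
    by (intro N.repr_independence[symmetric] N.is_subgroup) auto
  also have "\<dots> = K2_symbol R a b \<otimes>\<^bsub>K2 R\<^esub> K2_symbol R a' b"
    using mem by (simp add: K2_symbol_def K2_def N.rcos_sum)
  finally show ?thesis .
qed

lemma group_K2:
  assumes "ring R"
  shows "group (K2 R)"
  unfolding K2_def by (rule normal.factorgroup_is_group) (rule K2_relations_normal, fact)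

lemma K2_symbol_closed:
  assumes "a \<in> Units R" "b \<in> Units R"
  shows "K2_symbol R a b \<in> carrier (K2 R)"
  using assms by (auto simp: K2_symbol_def K2_def carrier_FactGroup K2_free_def)

lemma K2_symbol_cube_left:
  assumes R: "ring R" and units: "a \<in> Units R" "b \<in> Units R"
  shows "K2_symbol R (a \<otimes>\<^bsub>R\<^esub> a \<otimes>\<^bsub>R\<^esub> a) b = K2_symbol R a b [^]\<^bsub>K2 R\<^esub> (3::nat)"
proof -
  interpret ring R by fact
  interpret K2: group "K2 R"
    by (rule group_K2) fact
  show ?thesis
    using units K2_symbol_closed[OF units]
    by (simp add: K2_symbol_mult_left[OF R] numeral_3_eq_3)
qed

text \<open>
  The universal property of K2 in the form of a test for nontriviality.  The function \<open>t\<close> is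
  required to be bimultiplicative exactly but to satisfy the Steinberg relation only modulo \<open>H\<close>,
  so no quotient of \<open>G\<close> has to be formed.
\<close>

lemma K2_symbol_detect:
  fixes R :: "('a, 'm) ring_scheme" and G :: "('g, 'n) monoid_scheme"
  assumes R: "ring R" and G: "comm_group G" and H: "subgroup H G"
    and closed: "\<And>a b. a \<in> Units R \<Longrightarrow> b \<in> Units R \<Longrightarrow> t a b \<in> carrier G"
    and left: "\<And>a a' b. a \<in> Units R \<Longrightarrow> a' \<in> Units R \<Longrightarrow> b \<in> Units R \<Longrightarrow>
      t (a \<otimes>\<^bsub>R\<^esub> a') b = t a b \<otimes>\<^bsub>G\<^esub> t a' b"
    and right: "\<And>a b b'. a \<in> Units R \<Longrightarrow> b \<in> Units R \<Longrightarrow> b' \<in> Units R \<Longrightarrow>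
      t a (b \<otimes>\<^bsub>R\<^esub> b') = t a b \<otimes>\<^bsub>G\<^esub> t a b'"
    and steinberg: "\<And>a. a \<in> Units R \<Longrightarrow> \<one>\<^bsub>R\<^esub> \<ominus>\<^bsub>R\<^esub> a \<in> Units R \<Longrightarrow> t a (\<one>\<^bsub>R\<^esub> \<ominus>\<^bsub>R\<^esub> a) \<in> H"
    and units: "a \<in> Units R" "b \<in> Units R"
    and trivial: "K2_symbol R a b [^]\<^bsub>K2 R\<^esub> (n::nat) = \<one>\<^bsub>K2 R\<^esub>"
  shows "t a b [^]\<^bsub>G\<^esub> n \<in> H"
proof -
  interpret R: ring R by fact
  interpret G: comm_group G by fact
  interpret N: normal "generate (K2_free R) (K2_relators R)" "K2_free R"
    by (rule K2_relations_normal) fact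
  have "(\<lambda>x. t (fst x) (snd x)) ` (Units R \<times> Units R) \<subseteq> carrier G"
    using closed by auto
  from G.free_Abelian_group_universal[OF this, folded K2_free_def]
  obtain h where h: "h \<in> hom (K2_free R) G"
    and h_frag: "\<And>x. x \<in> Units R \<times> Units R \<Longrightarrow> h (frag_of x) = t (fst x) (snd x)"
    by blast
  interpret h: group_hom "K2_free R" G h
    by unfold_locales (rule h)
  have frag_mem: "frag_of (x, y) \<in> carrier (K2_free R)" if "x \<in> Units R" "y \<in> Units R" for x y
    using that by (simp add: K2_free_def)
  have h_t: "h (frag_of (x, y)) = t x y" if "x \<in> Units R" "y \<in> Units R" for x y
    using that h_frag[of "(x, y)"] by simp
  have minus: "f - (g + g') = f \<otimes>\<^bsub>K2_free R\<^esub> inv\<^bsub>K2_free R\<^esub> (g \<otimes>\<^bsub>K2_free R\<^esub> g')"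
    if "g \<in> carrier (K2_free R)" "g' \<in> carrier (K2_free R)" for f g g'
  proof -
    have "g \<otimes>\<^bsub>K2_free R\<^esub> g' \<in> carrier (K2_free R)"
      using that by blast
    then show ?thesis
      by (simp add: K2_free_def)
  qed
  have one_H: "\<one>\<^bsub>G\<^esub> \<in> H"
    by (rule subgroup.one_closed) fact
  let ?M = "{x \<in> carrier (K2_free R). h x \<in> H}"
  have "K2_relators R \<subseteq> ?M"
  proof
    fix x assume x: "x \<in> K2_relators R"
    then have "h x \<in> H"
      unfolding K2_relators_def
    proof (elim UnE CollectE exE conjE)
      fix a a' b assume "x = frag_of (a \<otimes>\<^bsub>R\<^esub> a', b) - (frag_of (a, b) + frag_of (a', b))"
        and "a \<in> Units R" "a' \<in> Units R" "b \<in> Units R"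
      then show ?thesis
        by (simp add: minus frag_mem h_t left closed one_H)
    next
      fix a b b' assume "x = frag_of (a, b \<otimes>\<^bsub>R\<^esub> b') - (frag_of (a, b) + frag_of (a, b'))"
        and "a \<in> Units R" "b \<in> Units R" "b' \<in> Units R"
      then show ?thesis
        by (simp add: minus frag_mem h_t right closed one_H)
    qed (simp add: h_t steinberg)
    then show "x \<in> ?M"
      using x K2_relators_subset[OF R] by blast
  qed
  moreover have "subgroup ?M (K2_free R)"
  proof (rule N.subgroupI)
    have "\<one>\<^bsub>K2_free R\<^esub> \<in> ?M"
      using one_H by simp
    then show "?M \<noteq> {}"
      by blast
  qed (auto intro: subgroup.m_closed[OF H] subgroup.m_inv_closed[OF H])
  ultimately have "generate (K2_free R) (K2_relators R) \<subseteq> ?M"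
    by (rule N.generate_subgroup_incl)
  moreover have "frag_of (a, b) [^]\<^bsub>K2_free R\<^esub> n \<in> generate (K2_free R) (K2_relators R)"
  proof (rule N.coset_join1)
    show "generate (K2_free R) (K2_relators R) #>\<^bsub>K2_free R\<^esub> frag_of (a, b) [^]\<^bsub>K2_free R\<^esub> n
        = generate (K2_free R) (K2_relators R)"
      using trivial N.FactGroup_pow[OF frag_mem[OF units], of n] by (simp add: K2_symbol_def K2_def)
  qed (use frag_mem units N.is_subgroup in auto)
  ultimately have "h (frag_of (a, b) [^]\<^bsub>K2_free R\<^esub> n) \<in> H"
    by blast
  then show ?thesis
    using h.hom_nat_pow[OF frag_mem[OF units], of n] by (simp add: h_t units)
qed

lemma Units_ring_on:
  assumes "subfield K ring_of_type_algebra"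
  shows "ring (ring_on K)" "Units (ring_on K) = K - {0}"
proof -
  interpret F: field "ring_of_type_algebra :: 'a ring"
    by (rule field_from_type_algebra)
  interpret K: field "ring_on K"
    unfolding ring_on_def by (rule F.subfield_iff(2)) fact
  show "ring (ring_on K)" ..
  show "Units (ring_on K) = K - {0}"
    using K.field_Units by (simp add: ring_on_def ring_of_type_algebra_def)
qed

lemma ring_on_simps [simp]:
  "\<one>\<^bsub>ring_on K\<^esub> = 1" "x \<otimes>\<^bsub>ring_on K\<^esub> y = x * y" "x \<oplus>\<^bsub>ring_on K\<^esub> y = x + y"
  "carrier (ring_on K) = K" "\<zero>\<^bsub>ring_on K\<^esub> = 0"
  by (simp_all add: ring_on_def ring_of_type_algebra_def)

lemma ring_on_minus:
  assumes "subfield K ring_of_type_algebra" "x \<in> K" "y \<in> K"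
  shows "x \<ominus>\<^bsub>ring_on K\<^esub> y = x - y"
proof -
  interpret K: ring "ring_on K"
    by (rule Units_ring_on) fact
  have "\<ominus>\<^bsub>ring_on K\<^esub> y \<oplus>\<^bsub>ring_on K\<^esub> y = \<zero>\<^bsub>ring_on K\<^esub>"
    using assms by (intro K.l_neg) simp
  then show ?thesis
    by (simp add: a_minus_def add_eq_0_iff2)
qed

section \<open>Integer polynomials and the minimal polynomial of an algebraic integer\<close>

lemma poly_map_poly_add:
  assumes "\<phi> 0 = 0" "\<And>a b. \<phi> (a + b) = \<phi> a + \<phi> b"
  shows "poly (map_poly \<phi> (g + h)) x = poly (map_poly \<phi> g) x + poly (map_poly \<phi> h) x"
  by (induction g h rule: poly_induct2) (simp_all add: map_poly_pCons assms algebra_simps)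

text \<open>
  Evaluation after a change of coefficients is a ring homomorphism; it is used for the integers
  as well as for the rationals.
\<close>

lemma poly_map_poly_mult:
  assumes "\<phi> 0 = 0" "\<And>a b. \<phi> (a + b) = \<phi> a + \<phi> b" "\<And>a b. \<phi> (a * b) = \<phi> a * \<phi> b"
  shows "poly (map_poly \<phi> (g * h)) x = poly (map_poly \<phi> g) x * poly (map_poly \<phi> h) x"
  by (induction g) (simp_all add: poly_map_poly_add map_poly_pCons map_poly_smult assms algebra_simps)

definition ipoly :: "int poly \<Rightarrow> 'a \<Rightarrow> 'a::comm_ring_1" where
  "ipoly g x = poly (map_poly of_int g) x"

lemma ipoly_pCons: "ipoly (pCons c g) x = of_int c + x * ipoly g x"
  by (simp add: ipoly_def map_poly_pCons)

lemma ipoly_0 [simp]: "ipoly 0 x = 0"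
  by (simp add: ipoly_def)

lemma ipoly_1 [simp]: "ipoly 1 x = 1"
  by (simp add: ipoly_def)

lemma ipoly_add [simp]: "ipoly (g + h) x = ipoly g x + ipoly h x"
  by (simp add: ipoly_def poly_map_poly_add)

lemma ipoly_mult [simp]: "ipoly (g * h) x = ipoly g x * ipoly h x"
  by (simp add: ipoly_def poly_map_poly_mult)

lemma ipoly_smult [simp]: "ipoly (Polynomial.smult c g) x = of_int c * ipoly g x"
  by (simp add: ipoly_def map_poly_smult)

lemma ipoly_minus [simp]: "ipoly (- g) x = - ipoly g x"
  using ipoly_smult[of "-1" g x] by simp

lemma ipoly_diff [simp]: "ipoly (g - h) x = ipoly g x - ipoly h x"
  using ipoly_add[of g "- h" x] by simp

lemma ipoly_monom [simp]: "ipoly (Polynomial.monom c n) x = of_int c * x ^ n"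
  by (simp add: ipoly_def map_poly_monom poly_monom)

lemma ipoly_of_int: "ipoly g (of_int n) = of_int (poly g n)"
  by (induction g) (simp_all add: ipoly_pCons)

lemma ex_prime_annihilator:
  fixes \<alpha> :: "'a::idom"
  assumes "h \<noteq> 0" "ipoly h \<alpha> = 0"
  shows "\<exists>g. prime_elem g \<and> g dvd h \<and> ipoly g \<alpha> = 0"
  using assms
proof (induction h rule: prime_divisors_induct)
  case (unit h)
  then obtain k where "h * k = 1"
    by (metis dvd_def)
  then have "ipoly h \<alpha> * ipoly k \<alpha> = 1"
    by (metis ipoly_1 ipoly_mult)
  then show ?case
    using unit by simp
next
  case (factor g h)
  show ?case
  proof (cases "ipoly g \<alpha> = 0")
    case True
    then show ?thesis
      using factor.hyps prime_imp_prime_elem dvd_triv_left[of g h] by (intro exI[of _ g]) simp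
  next
    case False
    then have "h \<noteq> 0" "ipoly h \<alpha> = 0"
      using factor.prems by auto
    then obtain g' where "prime_elem g'" "g' dvd h" "ipoly g' \<alpha> = 0"
      using factor.IH by blast
    then show ?thesis
      by (intro exI[of _ g']) simp
  qed
qed simp

text \<open>
  Start from an annihilating polynomial of least degree and pass to a prime factor that still
  annihilates \<open>\<alpha>\<close>.  Pseudo-division shows that this factor divides a constant multiple of every
  annihilating polynomial, and being prime of positive degree it divides the polynomial itself.
  This is Gauss's lemma in the shape needed here; the sign is adjusted at the end.
\<close>

lemma ex_monic_min_poly:
  fixes \<alpha> :: "'a::field_char_0"
  assumes T: "ipoly T \<alpha> = 0" "lead_coeff T = 1"
  shows "\<exists>g. lead_coeff g = 1 \<and> (\<forall>h. ipoly h \<alpha> = 0 \<longleftrightarrow> g dvd h)"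
proof -
  define S where "S = (\<lambda>m. m \<noteq> 0 \<and> ipoly m \<alpha> = 0)"
  have "S T"
    using T by (auto simp: S_def)
  then obtain m where m: "S m" "\<And>h. S h \<Longrightarrow> degree m \<le> degree h"
    using ex_has_least_nat[of S T degree] by blast
  obtain g where g: "prime_elem g" "g dvd m" "ipoly g \<alpha> = 0"
    using ex_prime_annihilator m(1) by (auto simp: S_def)
  have "g \<noteq> 0"
    using g(1) by auto
  have "degree g \<le> degree m"
    using g(2) m(1) by (intro dvd_imp_degree_le) (auto simp: S_def)
  then have min: "h = 0" if "ipoly h \<alpha> = 0" "h = 0 \<or> degree h < degree g" for h
    using m(2)[of h] that by (force simp: S_def)
  have dvd: "g dvd h" if h: "ipoly h \<alpha> = 0" for h
  proof -
    obtain a q where aq: "a \<noteq> 0" "smult a h = g * q + pseudo_mod h g"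
      using pseudo_mod(1)[OF \<open>g \<noteq> 0\<close>] by blast
    have "ipoly (pseudo_mod h g) \<alpha> = 0"
      using arg_cong[OF aq(2), of "\<lambda>h. ipoly h \<alpha>"] h g(3) by simp
    then have "pseudo_mod h g = 0"
      using min pseudo_mod(2)[OF \<open>g \<noteq> 0\<close>] by blast
    then have "[:a:] * h = g * q"
      using aq(2) by simp
    then have "g dvd [:a:] * h"
      by simp
    moreover have "\<not> g dvd [:a:]"
    proof
      assume "g dvd [:a:]"
      then have "degree g = 0"
        using aq(1) dvd_imp_degree_le[of g "[:a:]"] by simp
      then obtain b where "g = [:b:]"
        by (metis degree_eq_zeroE)
      then show False
        using \<open>g \<noteq> 0\<close> g(3) by (simp add: ipoly_pCons)
    qed
    ultimately show ?thesis
      using g(1) prime_elem_dvd_mult_iff by blast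
  qed
  obtain k where "T = g * k"
    using dvd T(1) by blast
  then have "lead_coeff g dvd 1"
    using T(2) by (metis dvd_triv_left lead_coeff_mult)
  then have lc: "lead_coeff g = 1 \<or> lead_coeff (- g) = 1"
    by auto
  have "ipoly h \<alpha> = 0 \<longleftrightarrow> g dvd h" for h
    using dvd g(3) by (auto elim!: dvdE)
  then show ?thesis
    using lc by (metis minus_dvd_iff)
qed

text \<open>
  A replacement for the norm: every nonzero element of \<open>\<int>[\<alpha>]\<close> divides a nonzero integer.  The Euclidean
  algorithm against the minimal polynomial, run with pseudo-division, produces the cofactor.
\<close>

lemma ex_multiple_constant:
  fixes \<alpha> :: "'a::field_char_0"
  assumes g: "g \<noteq> 0" "\<And>h. ipoly h \<alpha> = 0 \<longleftrightarrow> g dvd h" and h: "ipoly h \<alpha> \<noteq> 0"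
  shows "\<exists>k m. m \<noteq> 0 \<and> ipoly k \<alpha> * ipoly h \<alpha> = of_int m"
proof -
  have g0: "ipoly g \<alpha> = 0"
    using g(2) by simp
  have small: "\<exists>k m. m \<noteq> 0 \<and> ipoly k \<alpha> * ipoly h \<alpha> = of_int m"
    if "ipoly h \<alpha> \<noteq> 0" "degree h < degree g" for h
    using that
  proof (induction "degree h" arbitrary: h rule: less_induct)
    case less
    have "h \<noteq> 0"
      using less.prems by auto
    show ?case
    proof (cases "degree h = 0")
      case True
      then obtain m where "h = [:m:]"
        by (metis degree_eq_zeroE)
      then show ?thesis
        using \<open>h \<noteq> 0\<close> by (intro exI[of _ 1, OF exI[of _ m]]) (simp add: ipoly_pCons)
    next
      case False
      define r where "r = pseudo_mod g h"
      obtain a q where aq: "a \<noteq> 0" "smult a g = h * q + r"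
        using pseudo_mod(1)[OF \<open>h \<noteq> 0\<close>] unfolding r_def by blast
      have r: "r = 0 \<or> degree r < degree h"
        using pseudo_mod(2)[OF \<open>h \<noteq> 0\<close>] unfolding r_def by blast
      have eval: "ipoly r \<alpha> = - (ipoly h \<alpha> * ipoly q \<alpha>)"
        using arg_cong[OF aq(2), of "\<lambda>h. ipoly h \<alpha>"] g0 by (simp add: eq_neg_iff_add_eq_0 add.commute)
      have "ipoly r \<alpha> \<noteq> 0"
      proof
        assume *: "ipoly r \<alpha> = 0"
        have "r = 0"
        proof (rule ccontr)
          assume "r \<noteq> 0"
          then have "degree g \<le> degree r"
            using * g(2) by (intro dvd_imp_degree_le) auto
          then show False
            using r \<open>r \<noteq> 0\<close> less.prems(2) by simp
        qed
        then have aq': "smult a g = h * q"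
          using aq by simp
        then have "q \<noteq> 0"
          using aq(1) g(1) by auto
        moreover have "g dvd q"
          using eval * less.prems(1) g(2) by simp
        ultimately have "degree g \<le> degree q"
          by (intro dvd_imp_degree_le)
        moreover have "degree g = degree h + degree q"
          using arg_cong[OF aq', of degree] aq(1) \<open>h \<noteq> 0\<close> \<open>q \<noteq> 0\<close> by (simp add: degree_mult_eq)
        ultimately show False
          using False by simp
      qed
      moreover from this have "degree r < degree h"
        using r by auto
      ultimately obtain k m where "m \<noteq> 0" "ipoly k \<alpha> * ipoly r \<alpha> = of_int m"
        using less.hyps[of r] less.prems(2) by auto
      then show ?thesis
        by (intro exI[of _ "- (k * q)", OF exI[of _ m]]) (simp add: eval mult_ac)
    qed
  qed
  obtain a q where aq: "a \<noteq> 0" "smult a h = g * q + pseudo_mod h g"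
    using pseudo_mod(1)[OF g(1)] by blast
  have eval: "ipoly (pseudo_mod h g) \<alpha> = of_int a * ipoly h \<alpha>"
    using arg_cong[OF aq(2), of "\<lambda>h. ipoly h \<alpha>"] g0 by simp
  then have nz: "ipoly (pseudo_mod h g) \<alpha> \<noteq> 0"
    using aq(1) h by simp
  then have "degree (pseudo_mod h g) < degree g"
    using pseudo_mod(2)[OF g(1), of h] by auto
  then obtain k m where "m \<noteq> 0" "ipoly k \<alpha> * ipoly (pseudo_mod h g) \<alpha> = of_int m"
    using small nz by blast
  then show ?thesis
    by (intro exI[of _ "smult a k", OF exI[of _ m]]) (simp add: eval mult_ac)
qed

section \<open>Elements of a simple extension of the rationals\<close>

lemma rat_adjoin_fraction:
  fixes \<alpha> :: "'a::field_char_0"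
  assumes "x \<in> rat_adjoin \<alpha>"
  shows "\<exists>h s. ipoly s \<alpha> \<noteq> 0 \<and> x = ipoly h \<alpha> / ipoly s \<alpha>"
proof -
  interpret F: field "ring_of_type_algebra :: 'a ring"
    by (rule field_from_type_algebra)
  note ring_simps = ring_of_type_algebra_def
  have ainv: "\<ominus>\<^bsub>ring_of_type_algebra\<^esub> y = - y" for y :: 'a
    by (rule F.minus_equality) (simp_all add: ring_simps)
  have minv: "inv\<^bsub>ring_of_type_algebra\<^esub> y = inverse y" if "y \<noteq> 0" for y :: 'a
    using that by (intro F.comm_inv_char) (simp_all add: ring_simps)
  show ?thesis
    using assms unfolding rat_adjoin_def
  proof (induction rule: generate_field.induct)
    case one
    show ?case
      by (intro exI[of _ 1]) (simp add: ring_simps)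
  next
    case (incl x)
    show ?case
    proof (cases "x = \<alpha>")
      case True
      then show ?thesis
        by (intro exI[of _ "[:0, 1:]", OF exI[of _ 1]]) (simp add: ipoly_pCons)
    next
      case False
      with incl obtain a b where "b > 0" "x = of_int a / of_int b"
        by (auto elim!: Rats_cases')
      then show ?thesis
        by (intro exI[of _ "[:a:]", OF exI[of _ "[:b:]"]]) (simp add: ipoly_pCons)
    qed
  next
    case (a_inv x)
    then obtain h s where "ipoly s \<alpha> \<noteq> 0" "x = ipoly h \<alpha> / ipoly s \<alpha>"
      by blast
    then show ?case
      by (intro exI[of _ "- h", OF exI[of _ s]]) (simp add: ainv)
  next
    case (m_inv x)
    then obtain h s where "ipoly s \<alpha> \<noteq> 0" "x = ipoly h \<alpha> / ipoly s \<alpha>"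
      by blast
    moreover have "x \<noteq> 0"
      using m_inv by (simp add: ring_simps)
    ultimately show ?case
      by (intro exI[of _ s, OF exI[of _ h]]) (simp add: minv)
  next
    case (eng_add x y)
    then obtain h s h' s' where *: "ipoly s \<alpha> \<noteq> 0" "x = ipoly h \<alpha> / ipoly s \<alpha>"
        "ipoly s' \<alpha> \<noteq> 0" "y = ipoly h' \<alpha> / ipoly s' \<alpha>"
      by blast
    show ?case
      by (intro exI[of _ "h * s' + h' * s", OF exI[of _ "s * s'"]])
        (use * in \<open>simp add: ring_simps add_frac_eq\<close>)
  next
    case (eng_mult x y)
    then obtain h s h' s' where *: "ipoly s \<alpha> \<noteq> 0" "x = ipoly h \<alpha> / ipoly s \<alpha>"
        "ipoly s' \<alpha> \<noteq> 0" "y = ipoly h' \<alpha> / ipoly s' \<alpha>"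
      by blast
    show ?case
      by (intro exI[of _ "h * h'", OF exI[of _ "s * s'"]]) (use * in \<open>simp add: ring_simps\<close>)
  qed
qed

lemma ipoly_in_rat_adjoin: "ipoly h \<alpha> \<in> rat_adjoin (\<alpha> :: 'a::field_char_0)"
proof -
  have closed: "x + y \<in> rat_adjoin \<alpha>" "x * y \<in> rat_adjoin \<alpha>"
    if "x \<in> rat_adjoin \<alpha>" "y \<in> rat_adjoin \<alpha>" for x y
    using generate_field.eng_add[of x "ring_of_type_algebra :: 'a ring" _ y]
      generate_field.eng_mult[of x "ring_of_type_algebra :: 'a ring" _ y] that
    by (simp_all add: rat_adjoin_def ring_of_type_algebra_def)
  have "\<alpha> \<in> rat_adjoin \<alpha>" "of_int m \<in> rat_adjoin \<alpha>" for m
    by (auto simp: rat_adjoin_def intro: generate_field.incl)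
  then show ?thesis
    by (induction h) (auto simp: ipoly_pCons intro!: closed intro: \<open>of_int 0 \<in> rat_adjoin \<alpha>\<close>[simplified])
qed

section \<open>Values at -2 of the factors of the trinomial\<close>

abbreviation trinomial :: "nat \<Rightarrow> int poly" where
  "trinomial p \<equiv> Polynomial.monom 1 p + [:1, 1:]"

lemma arith_geo_mean_3:
  fixes x y z :: real
  assumes "x \<ge> 0" "y \<ge> 0" "z \<ge> 0"
  shows "27 * (x * y * z) \<le> (x + y + z) ^ 3"
proof -
  have "(x + y + z) ^ 3 - 27 * (x * y * z)
      = (x + y + z) * ((x - y)\<^sup>2 + (y - z)\<^sup>2 + (z - x)\<^sup>2) / 2
        + 3 * (x * (y - z)\<^sup>2 + y * (z - x)\<^sup>2 + z * (x - y)\<^sup>2)"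
    by (simp add: power2_eq_square power3_eq_cube field_simps)
  also have "\<dots> \<ge> 0"
    using assms by (intro add_nonneg_nonneg mult_nonneg_nonneg divide_nonneg_nonneg) auto
  finally show ?thesis
    by simp
qed

text \<open>
  With \<open>t = \<bar>z\<bar>\<^sup>2\<close> the equation gives \<open>\<bar>z + 1\<bar>\<^sup>2 = t^p\<close>, hence \<open>\<bar>z + 2\<bar>\<^sup>2 = 2 t^p - t + 2\<close>.
  This is at least \<open>t^p + t^(p - 1) + 1\<close> because \<open>(t - 1) (t^(p - 1) - 1) \<ge> 0\<close>, and the three
  summands have product \<open>t^(2p - 1)\<close>.
\<close>

lemma trinomial_root_norm:
  fixes z :: complex
  assumes "p > 0" "z ^ p + z + 1 = 0"
  shows "27 * ((cmod z)\<^sup>2) ^ (2 * p - 1) \<le> ((cmod (z + 2))\<^sup>2) ^ 3"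
proof -
  define t where "t = (cmod z)\<^sup>2"
  have t: "t \<ge> 0"
    by (simp add: t_def)
  have "z ^ p = - (z + 1)"
    using assms(2) by (metis add.assoc eq_neg_iff_add_eq_0)
  then have "cmod (z ^ p) = cmod (z + 1)"
    by (metis norm_minus_cancel)
  then have "(cmod (z + 1))\<^sup>2 = t ^ p"
    by (metis norm_power power_commutes power_mult t_def mult.commute)
  moreover have "(cmod (z + 2))\<^sup>2 = 2 * (cmod (z + 1))\<^sup>2 - t + 2"
    unfolding t_def cmod_power2 by (simp add: power2_eq_square algebra_simps)
  ultimately have val: "(cmod (z + 2))\<^sup>2 = 2 * t ^ p - t + 2"
    by simp
  obtain k where k: "p = Suc k"
    using assms(1) by (cases p) auto
  have "(t - 1) * (t ^ k - 1) \<ge> 0"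
  proof (cases "t \<ge> 1")
    case True
    then show ?thesis
      by (simp add: one_le_power)
  next
    case False
    then show ?thesis
      using t by (intro mult_nonpos_nonpos) (simp_all add: power_le_one)
  qed
  then have "t ^ Suc k + t ^ k + 1 \<le> 2 * t ^ p - t + 2"
    by (simp add: k algebra_simps)
  then have "(t ^ Suc k + t ^ k + 1) ^ 3 \<le> (2 * t ^ p - t + 2) ^ 3"
    using t by (intro power_mono add_nonneg_nonneg) auto
  moreover have "27 * (t ^ Suc k * t ^ k * 1) \<le> (t ^ Suc k + t ^ k + 1) ^ 3"
    using t by (intro arith_geo_mean_3) auto
  moreover have "t ^ Suc k * t ^ k * 1 = t ^ (2 * p - 1)"
    by (simp add: k mult_2 flip: power_add)
  ultimately show ?thesis
    by (simp add: val flip: t_def)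
qed

text \<open>
  Take the product of the bounds for the individual roots.  The factors \<open>\<bar>z\<bar>\<close> disappear because the
  constant term of a factor of the trinomial is \<open>\<plusminus>1\<close>.
\<close>

lemma factor_value_bound:
  fixes g :: "int poly"
  assumes "p > 0" "g dvd trinomial p" "lead_coeff g = 1"
  shows "27 ^ degree g \<le> (poly g (-2)) ^ 6"
proof -
  define G :: "complex poly" where "G = map_poly of_int g"
  have deg: "degree G = degree g"
    unfolding G_def by (rule degree_map_poly) auto
  have lc: "lead_coeff G = 1"
    unfolding deg by (simp add: G_def coeff_map_poly assms(3))
  have poly_G: "poly G (of_int x) = of_int (poly g x)" for x
    using ipoly_of_int[of g x] by (simp add: G_def ipoly_def)
  obtain r where r: "G = (\<Prod>i<degree g. [:- r i, 1:])"
    using complex_poly_decompose'[of G] lc deg by (metis smult_1_left)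
  have norm_G: "\<bar>of_int (poly g x)\<bar> = (\<Prod>i<degree g. cmod (of_int x - r i))" for x
  proof -
    have "\<bar>of_int (poly g x)\<bar> = cmod (poly G (of_int x))"
      by (simp add: poly_G)
    also have "\<dots> = (\<Prod>i<degree g. cmod (of_int x - r i))"
      by (simp add: r poly_prod prod_norm)
    finally show ?thesis .
  qed
  have root: "r i ^ p + r i + 1 = 0" if "i < degree g" for i
  proof -
    obtain h where h: "trinomial p = g * h"
      using assms(2) by blast
    have "poly G (r i) = 0"
      using that by (auto simp: r poly_prod)
    then have "ipoly g (r i) = 0"
      by (simp add: ipoly_def G_def)
    then have "ipoly (trinomial p) (r i) = 0"
      unfolding h by simp
    then show ?thesis
      by (simp add: ipoly_pCons algebra_simps)
  qed
  have "poly g 0 dvd poly (trinomial p) 0"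
    using assms(2) by (metis dvd_def poly_mult)
  then have "\<bar>poly g 0\<bar> = 1"
    using assms(1) by (simp add: poly_monom zero_power)
  then have prod_one: "(\<Prod>i<degree g. cmod (r i)) = 1"
  proof -
    have "\<bar>of_int (poly g 0) :: real\<bar> = of_int \<bar>poly g 0\<bar>"
      by simp
    also have "\<dots> = 1"
      using \<open>\<bar>poly g 0\<bar> = 1\<close> by simp
    finally show ?thesis
      using norm_G[of 0] by simp
  qed
  have "27 ^ degree g = (\<Prod>i<degree g. 27) * ((\<Prod>i<degree g. cmod (r i))\<^sup>2) ^ (2 * p - 1)"
    by (simp add: prod_one)
  also have "\<dots> = (\<Prod>i<degree g. 27 * ((cmod (r i))\<^sup>2) ^ (2 * p - 1))"
    by (simp only: prod.distrib prod_power_distrib)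
  also have "\<dots> \<le> (\<Prod>i<degree g. ((cmod (r i + 2))\<^sup>2) ^ 3)"
  proof (rule prod_mono, intro conjI)
    fix i assume "i \<in> {..<degree g}"
    then show "27 * ((cmod (r i))\<^sup>2) ^ (2 * p - 1) \<le> ((cmod (r i + 2))\<^sup>2) ^ 3"
      using root assms(1) by (intro trinomial_root_norm) simp_all
  qed simp
  also have "\<dots> = ((\<Prod>i<degree g. cmod (r i + 2))\<^sup>2) ^ 3"
    by (simp only: prod_power_distrib)
  also have "(\<Prod>i<degree g. cmod (r i + 2)) = (\<Prod>i<degree g. cmod (of_int (-2) - r i))"
  proof (rule prod.cong)
    fix i
    have "of_int (-2) - r i = - (r i + 2)"
      by simp
    then show "cmod (r i + 2) = cmod (of_int (-2) - r i)"
      by (simp only: norm_minus_cancel)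
  qed simp
  also have "\<dots> = \<bar>of_int (poly g (-2))\<bar>"
    by (rule norm_G[symmetric])
  also have "(\<bar>of_int (poly g (-2)) :: real\<bar>\<^sup>2) ^ 3 = of_int ((poly g (-2)) ^ 6)"
    by (simp flip: power_mult)
  finally have "real_of_int (27 ^ degree g) \<le> of_int ((poly g (-2)) ^ 6)"
    by simp
  then show ?thesis
    by (simp only: of_int_le_iff)
qed

text \<open>
  The bound \<open>27^(deg g) \<le> g(-2)^6\<close> settles degree at least 3.  In the remaining degrees the values
  of the trinomial at 0, 1 and -1 show that \<open>g(0)\<close>, \<open>g(1)\<close> and \<open>g(-1)\<close> divide 1, 3 and 1.  This
  is impossible in degree 1.  In degree 2 the bound leaves the case \<open>\<bar>g(-2)\<bar> = 3\<close>, and then the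
  divisibilities force \<open>g = X\<^sup>2 + X + 1\<close>.
\<close>

lemma factor_value_gt_3:
  fixes g :: "int poly"
  assumes "odd p" "g dvd trinomial p" "lead_coeff g = 1" "degree g > 0" "g \<noteq> [:1, 1, 1:]"
  shows "\<bar>poly g (-2)\<bar> > 3"
proof (rule ccontr)
  assume "\<not> ?thesis"
  then have le: "\<bar>poly g (-2)\<bar> \<le> 3"
    by simp
  have p: "p > 0"
    using assms(1) by (cases p) auto
  have dvd: "poly g x dvd poly (trinomial p) x" for x
    using assms(2) by (metis dvd_def poly_mult)
  have "27 ^ degree g \<le> \<bar>poly g (-2)\<bar> ^ 6"
    using factor_value_bound[OF p assms(2,3)] by (simp add: power_even_abs)
  also have "\<dots> \<le> 3 ^ 6"
    using le by (intro power_mono) auto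
  also have "(3::int) ^ 6 = 27 ^ 2"
    by simp
  finally have "degree g \<le> 2"
    by (rule power_le_imp_le_exp[rotated]) simp_all
  then consider "degree g = 1" | "degree g = 2"
    using assms(4) by linarith
  then show False
  proof cases
    case 1
    define c where "c = coeff g 0"
    have g: "g = [:c, 1:]"
    proof (rule poly_eqI)
      fix n
      show "coeff g n = coeff [:c, 1:] n"
        using 1 assms(3) coeff_eq_0[of g n]
        by (auto simp: c_def coeff_pCons split: nat.split)
    qed
    have "c dvd 1" "1 + c dvd 3"
      using dvd[of 0] dvd[of 1] p by (simp_all add: g poly_monom zero_power add.commute)
    then have "c = 1 \<or> c = -1"
      by auto
    then show False
      using \<open>1 + c dvd 3\<close> by auto
  next
    case 2
    define b c where "b = coeff g 1" and "c = coeff g 0"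
    have g: "g = [:c, b, 1:]"
    proof (rule poly_eqI)
      fix n
      show "coeff g n = coeff [:c, b, 1:] n"
        using 2 assms(3) coeff_eq_0[of g n]
        by (auto simp: b_def c_def coeff_pCons numeral_2_eq_2 split: nat.split)
    qed
    have val: "poly g (-2) = c - 2 * b + 4"
      by (simp add: g)
    have "\<bar>poly g (-2)\<bar> \<ge> 3"
    proof -
      have "(3::int) ^ 6 \<le> \<bar>poly g (-2)\<bar> ^ 6"
        using factor_value_bound[OF p assms(2,3)] 2 by (simp add: power_even_abs)
      then show ?thesis
        by (rule power_le_imp_le_base[where n = 5, simplified]) simp
    qed
    with le have 3: "\<bar>c - 2 * b + 4\<bar> = 3"
      by (simp add: val)
    have "c dvd 1" "1 + b + c dvd 3" "1 - b + c dvd 1"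
      using dvd[of 0] dvd[of 1] dvd[of "-1"] p assms(1) by (simp_all add: g poly_monom zero_power algebra_simps)
    then have "c = 1 \<or> c = -1" "1 - b + c = 1 \<or> 1 - b + c = -1"
      by auto
    then have "c = 1 \<and> b = 1 \<or> c = 1 \<and> b = 3"
      using 3 by auto
    then show False
      using assms(5) \<open>1 + b + c dvd 3\<close> by (auto simp: g dest: zdvd_imp_le)
  qed
qed

section \<open>Primes dividing 2^p + 1\<close>

lemma nine_not_dvd_two_power_plus_1:
  assumes "Factorial_Ring.prime p" "p > 3"
  shows "\<not> (9::nat) dvd 2 ^ p + 1"
proof -
  have "\<not> 2 dvd p" "\<not> 3 dvd p"
    using assms by (auto simp: prime_nat_iff)
  then have "p mod 6 = 1 \<or> p mod 6 = 5"
    by presburger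
  moreover have "(2::nat) ^ p mod 9 = 2 ^ (p mod 6) mod 9"
  proof -
    have "(2::nat) ^ p = (2 ^ 6) ^ (p div 6) * 2 ^ (p mod 6)"
      by (simp only: power_mult[symmetric] power_add[symmetric] mult_div_mod_eq)
    also have "\<dots> mod 9 = ((2 ^ 6 mod 9) ^ (p div 6) mod 9) * 2 ^ (p mod 6) mod 9"
      by (simp only: power_mod mod_mult_left_eq)
    finally show ?thesis
      by simp
  qed
  ultimately have "(2::nat) ^ p mod 9 = 2 \<or> (2::nat) ^ p mod 9 = 5"
    by auto
  then show ?thesis
    by presburger
qed

text \<open>
  Otherwise \<open>N = 3^a m^p\<close>.  The number \<open>m\<close> is odd, and \<open>m \<ge> 3\<close> is impossible because
  \<open>3^p > 2^p + 1\<close>; so \<open>N = 3^a\<close>, and \<open>a \<le> 1\<close> because 9 does not divide \<open>2^p + 1\<close>.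
\<close>

lemma ex_prime_multiplicity_not_dvd:
  fixes N :: nat
  assumes p: "Factorial_Ring.prime p" "p > 3" and N: "N dvd 2 ^ p + 1" "N > 3"
  shows "\<exists>l. Factorial_Ring.prime l \<and> l \<noteq> 3 \<and> \<not> p dvd multiplicity l N"
proof (rule ccontr)
  assume *: "\<not> ?thesis"
  define a where "a = multiplicity 3 N"
  obtain M where M: "N = 3 ^ a * M" "\<not> 3 dvd M"
    unfolding a_def using N(2) by (metis multiplicity_decompose' nat_dvd_1_iff_1 not_less_zero numeral_eq_one_iff semiring_norm(86))
  have M0: "M \<noteq> 0"
    using M(2) by (metis dvd_0_right)
  have "p dvd multiplicity l M" if l: "Factorial_Ring.prime l" for l
  proof (cases "l = 3")
    case True
    then show ?thesis
      using M(2) by (simp add: not_dvd_imp_multiplicity_0)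
  next
    case False
    have "\<not> l dvd 3 ^ a"
      using False l primes_dvd_imp_eq[of l 3] by (auto dest: prime_dvd_power)
    then have "multiplicity l N = multiplicity l M"
      using l M0 by (simp add: M(1) prime_elem_multiplicity_mult_distrib not_dvd_imp_multiplicity_0)
    then show ?thesis
      using * False l by metis
  qed
  then have "is_nth_power p M"
    using p by (subst is_nth_power_conv_multiplicity_nat) (auto simp: prime_gt_0_nat)
  then obtain m where m: "M = m ^ p"
    by (auto simp: is_nth_power_def)
  have "M dvd 2 ^ p + 1"
    using N(1) M(1) by (metis dvd_mult_right)
  moreover have "odd ((2::nat) ^ p + 1)"
    using p by simp
  ultimately have "odd m"
    using m p by (metis dvd_power dvd_trans gr_zeroI not_less_zero)
  moreover have "m < 3"
  proof (rule ccontr)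
    assume "\<not> m < 3"
    then have "3 ^ p \<le> M"
      by (simp add: m power_mono)
    also have "M \<le> 2 ^ p + 1"
      using \<open>M dvd 2 ^ p + 1\<close> by (rule dvd_imp_le) simp
    also have "(2::nat) ^ p + 1 < 3 ^ p"
    proof -
      have "(2::nat) ^ n + 1 < 3 ^ n" if "n \<ge> 2" for n
        using that by (induction n rule: dec_induct) (auto simp: eval_nat_numeral)
      then show ?thesis
        using p(2) by simp
    qed
    finally show False
      by simp
  qed
  ultimately have "m = 1"
    by (cases m) (auto simp: less_Suc_eq numeral_3_eq_3)
  then have N3: "N = 3 ^ a"
    using M(1) m by simp
  have "a < 2"
  proof (rule ccontr)
    assume "\<not> a < 2"
    then have "(3::nat) ^ 2 dvd 3 ^ a"
      by (intro le_imp_power_dvd) simp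
    then have "9 dvd N"
      by (simp add: N3)
    then show False
      using N(1) nine_not_dvd_two_power_plus_1[OF p] dvd_trans by blast
  qed
  then have "N \<le> 3"
    by (cases a) (auto simp: N3 less_Suc_eq)
  with N(2) show False
    by simp
qed

text \<open>
  It is convenient to work with \<open>4 = (-2)\<^sup>2\<close>, a natural number: \<open>4^p \<equiv> 1\<close> and, as \<open>l \<noteq> 3\<close>,
  \<open>4\<close> is not \<open>1\<close> modulo \<open>l\<close>, so its order is the prime \<open>p\<close>.
\<close>

lemma order_minus_two:
  assumes p: "Factorial_Ring.prime p" and l: "Factorial_Ring.prime l" "l \<noteq> 3" "l dvd 2 ^ p + 1"
  shows "int l dvd (-2) ^ (2 * k) - 1 \<Longrightarrow> p dvd k" and "p dvd l - 1"
proof -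
  have odd: "odd l"
    using l(3) p by (metis dvd_add_right_iff dvd_power dvd_trans odd_one prime_gt_0_nat)
  have "int l dvd 2 ^ p + 1"
    using l(3) of_nat_dvd_iff[of l "2 ^ p + 1", where 'a = int] by (simp add: add.commute)
  then have "int l dvd (2 ^ p + 1) * (2 ^ p - 1)"
    by (rule dvd_mult2)
  also have "(2 ^ p + 1) * (2 ^ p - 1) = (4 ^ p - 1 :: int)"
    by (simp add: algebra_simps flip: power_mult_distrib)
  finally have "[4 ^ p = 1] (mod l)"
    by (metis cong_iff_dvd_diff cong_int_iff of_nat_1 of_nat_numeral of_nat_power)
  then have "ord l 4 dvd p"
    using ord_divides by blast
  moreover have "ord l 4 \<noteq> 1"
  proof
    assume "ord l 4 = 1"
    then have "[4 ^ 1 = 1] (mod l)"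
      by (metis ord_divides dvd_refl)
    then have "l dvd 3"
      by (simp add: cong_altdef_nat)
    then show False
      using l primes_dvd_imp_eq[of l 3] by simp
  qed
  ultimately have ord: "ord l 4 = p"
    using p by (auto simp: prime_nat_iff)
  have "coprime l 4"
    using odd coprime_power_right_iff[of l 2 2] by simp
  then have "ord l 4 dvd totient l"
    by (intro order_divides_totient)
  then show "p dvd l - 1"
    using l(1) by (simp add: ord totient_prime)
  assume "int l dvd (-2) ^ (2 * k) - 1"
  then have "int l dvd 4 ^ k - 1"
    by (simp add: power_mult)
  then have "[4 ^ k = 1] (mod l)"
    by (metis cong_iff_dvd_diff cong_int_iff of_nat_1 of_nat_numeral of_nat_power)
  then show "p dvd k"
    using ord_divides ord by blast
qed

text \<open>
  Twice the derivative at \<open>-2\<close> is congruent to \<open>2 - p\<close> modulo \<open>l\<close>, and \<open>l > p\<close> because \<open>p\<close>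
  divides \<open>l - 1\<close>.
\<close>

lemma trinomial_simple_root:
  assumes p: "Factorial_Ring.prime p" "p > 3"
    and l: "Factorial_Ring.prime l" "l \<noteq> 3" "l dvd 2 ^ p + 1"
  shows "\<not> int l dvd poly (pderiv (trinomial p)) (-2)"
proof
  assume *: "int l dvd poly (pderiv (trinomial p)) (-2)"
  have odd: "odd p"
    using p by (auto simp: prime_odd_nat)
  have "(-2) * poly (pderiv (trinomial p)) (-2) = int p * (-2) ^ p - 2"
  proof -
    have "(-2 :: int) ^ p = (-2) * (-2) ^ (p - 1)"
      using p by (metis power_eq_if not_less_zero)
    then show ?thesis
      by (simp add: pderiv_monom pderiv_add poly_monom pderiv_pCons algebra_simps)
  qed
  then have "int l dvd int p * (-2) ^ p - 2"
    using * by (metis dvd_mult)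
  moreover have "int l dvd int p * (2 ^ p + 1)"
    using l(3) of_nat_dvd_iff[of l "2 ^ p + 1", where 'a = int] by (intro dvd_mult) (simp add: add.commute)
  ultimately have "int l dvd (int p * (-2) ^ p - 2) + int p * (2 ^ p + 1)"
    by (rule dvd_add)
  also have "\<dots> = int (p - 2)"
    using odd p by (simp add: algebra_simps of_nat_diff)
  finally have "l dvd p - 2"
    by simp
  then have "l \<le> p - 2"
    using p by (intro dvd_imp_le) auto
  moreover have "p \<le> l - 1"
    using order_minus_two(2)[OF p(1) l] prime_gt_1_nat[OF l(1)] by (intro dvd_imp_le) auto
  ultimately show False
    using p by linarith
qed

lemma multiplicity_int_nat_abs: "multiplicity (int l) x = multiplicity l (nat \<bar>x\<bar>)"
proof -
  have "int l ^ n dvd x \<longleftrightarrow> l ^ n dvd nat \<bar>x\<bar>" for n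
    using int_dvd_int_iff[of "l ^ n" "nat \<bar>x\<bar>"] by simp
  then show ?thesis
    by (simp add: multiplicity_def)
qed

section \<open>The valuation attached to a simple root modulo a prime\<close>

text \<open>
  Here \<open>g\<close> is the minimal polynomial of \<open>\<alpha>\<close>, and \<open>c\<close> is a simple root of it modulo \<open>l\<close>.  Reduction
  \<open>\<alpha> \<mapsto> c\<close> then defines a ring homomorphism from \<open>\<int>[\<alpha>]\<close> to the field with \<open>l\<close> elements, and the
  prime ideal \<open>(l, \<alpha> - c)\<close> of \<open>\<int>[\<alpha>]\<close> is unramified of degree one.
\<close>

locale simple_root_mod_prime =
  fixes \<alpha> :: "'a::field_char_0" and g :: "int poly" and l :: nat and c :: int
  assumes prime_l: "Factorial_Ring.prime l"
    and g_nonzero: "g \<noteq> 0"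
    and annihilates_iff: "ipoly h \<alpha> = 0 \<longleftrightarrow> g dvd h"
    and root_mod: "int l dvd poly g c"
    and simple_mod: "\<not> int l dvd poly (pderiv g) c"
begin

text \<open>
  The localisation of \<open>\<int>[\<alpha>]\<close> at the kernel of reduction.
\<close>

definition R :: "'a set" where
  "R = {ipoly h \<alpha> / ipoly s \<alpha> | h s. \<not> int l dvd poly s c}"

lemma prime_int_l: "Factorial_Ring.prime (int l)"
  using prime_l by simp

lemma dvd_if_annihilates: "ipoly h \<alpha> = 0 \<Longrightarrow> int l dvd poly h c"
  using root_mod annihilates_iff[of h] by (auto elim!: dvdE)

lemma denominator_nonzero: "\<not> int l dvd poly s c \<Longrightarrow> ipoly s \<alpha> \<noteq> 0"
  using dvd_if_annihilates by blast

lemma R_I: "\<not> int l dvd poly s c \<Longrightarrow> ipoly h \<alpha> / ipoly s \<alpha> \<in> R"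
  unfolding R_def by blast

lemma R_E:
  assumes "x \<in> R"
  obtains h s where "x = ipoly h \<alpha> / ipoly s \<alpha>" "\<not> int l dvd poly s c" "ipoly s \<alpha> \<noteq> 0"
  using assms denominator_nonzero unfolding R_def by blast

lemma l_not_unit: "\<not> int l dvd 1"
  using prime_l not_prime_unit by auto

lemma ipoly_mem: "ipoly h \<alpha> \<in> R"
  using R_I[of 1 h] l_not_unit by simp

text \<open>
  Says that \<open>l R\<close> meets \<open>\<int>[\<alpha>]\<close> only in the kernel of reduction, so residues can be read off.
\<close>

lemma dvd_if_multiple:
  assumes "ipoly h \<alpha> = of_nat l * y" "y \<in> R"
  shows "int l dvd poly h c"
proof -
  obtain k s where y: "y = ipoly k \<alpha> / ipoly s \<alpha>" "\<not> int l dvd poly s c" "ipoly s \<alpha> \<noteq> 0"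
    using assms(2) by (rule R_E)
  then have "ipoly (h * s - smult (int l) k) \<alpha> = 0"
    using assms(1) by simp
  then have "int l dvd poly (h * s - smult (int l) k) c"
    by (rule dvd_if_annihilates)
  then have "int l dvd poly h c * poly s c"
    by (simp add: dvd_diff_left_iff)
  then show ?thesis
    using y(2) prime_int_l by (simp add: prime_dvd_mult_iff)
qed

sublocale local_ring_with_uniformizer R "of_nat l"
proof
  show "1 \<in> R"
    using ipoly_mem[of 1] by simp
  show "of_nat l \<in> R"
    using ipoly_mem[of "[:int l:]"] by (simp add: ipoly_pCons)
  have l: "(of_nat l :: 'a) \<noteq> 0"
    using prime_l by (auto simp: prime_nat_iff)
  show "inverse (of_nat l) \<notin> R"
  proof
    assume "inverse (of_nat l) \<in> R"
    then have "int l dvd poly 1 c"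
      using l by (intro dvd_if_multiple[of 1 "inverse (of_nat l)"]) simp_all
    then show False
      using l_not_unit by simp
  qed
next
  fix x y assume "x \<in> R" "y \<in> R"
  obtain h s where x: "x = ipoly h \<alpha> / ipoly s \<alpha>" "\<not> int l dvd poly s c" "ipoly s \<alpha> \<noteq> 0"
    using \<open>x \<in> R\<close> by (rule R_E)
  obtain k t where y: "y = ipoly k \<alpha> / ipoly t \<alpha>" "\<not> int l dvd poly t c" "ipoly t \<alpha> \<noteq> 0"
    using \<open>y \<in> R\<close> by (rule R_E)
  have st: "\<not> int l dvd poly (s * t) c"
    using x(2) y(2) prime_int_l by (simp add: prime_dvd_mult_iff)
  have "x - y = ipoly (h * t - k * s) \<alpha> / ipoly (s * t) \<alpha>"
    unfolding x(1) y(1) using x(3) y(3) by (simp add: diff_frac_eq)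
  then show "x - y \<in> R"
    using R_I[OF st, of "h * t - k * s"] by simp
  have "x * y = ipoly (h * k) \<alpha> / ipoly (s * t) \<alpha>"
    using x y by simp
  then show "x * y \<in> R"
    using R_I[OF st, of "h * k"] by simp
next
  fix x assume "x \<in> R"
  then obtain h s where x: "x = ipoly h \<alpha> / ipoly s \<alpha>" "\<not> int l dvd poly s c" "ipoly s \<alpha> \<noteq> 0"
    by (rule R_E)
  have "1 - of_nat l * x = ipoly (s - smult (int l) h) \<alpha> / ipoly s \<alpha>"
    using x by (simp add: field_simps)
  then have "inverse (1 - of_nat l * x) = ipoly s \<alpha> / ipoly (s - smult (int l) h) \<alpha>"
    by simp
  moreover have "\<not> int l dvd poly (s - smult (int l) h) c"
    using x(2) by (simp add: dvd_diff_left_iff)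
  ultimately show "inverse (1 - of_nat l * x) \<in> R"
    using R_I[of "s - smult (int l) h" s] by simp
qed

lemma fraction_in_U:
  assumes "\<not> int l dvd poly h c" "\<not> int l dvd poly s c"
  shows "ipoly h \<alpha> / ipoly s \<alpha> \<in> U"
  using assms R_I[of s h] R_I[of h s] by (auto simp: U_def denominator_nonzero)

lemma ipoly_in_U: "\<not> int l dvd poly h c \<Longrightarrow> ipoly h \<alpha> \<in> U"
  using fraction_in_U[of h 1] l_not_unit by simp

lemma divide_linear:
  obtains q where "h = [:- c, 1:] * q + [:poly h c:]"
proof -
  have "poly (h - [:poly h c:]) c = 0"
    by simp
  then obtain q where "h - [:poly h c:] = [:- c, 1:] * q"
    unfolding poly_eq_0_iff_dvd by (auto elim: dvdE)
  then show ?thesis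
    using that[of q] by (simp add: algebra_simps)
qed

text \<open>
  Dividing \<open>g\<close> by \<open>X - c\<close> gives \<open>0 = (\<alpha> - c) q(\<alpha>) + g(c)\<close>, and \<open>q(c) = g'(c)\<close> is a unit modulo
  \<open>l\<close>.  Thus \<open>\<alpha> - c\<close> is \<open>g(c)\<close> up to a unit of \<open>R\<close>; this one identity makes the maximal ideal
  principal, generated by \<open>l\<close>, and computes the valuation of \<open>\<alpha> - c\<close>.
\<close>

lemma generator_eq:
  obtains q where "\<not> int l dvd poly q c" "\<alpha> - of_int c = - of_int (poly g c) / ipoly q \<alpha>"
proof -
  obtain q where q: "g = [:- c, 1:] * q + [:poly g c:]"
    by (rule divide_linear)
  have "poly (pderiv g) c = poly (pderiv ([:- c, 1:] * q + [:poly g c:])) c"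
    using arg_cong[OF q, of "\<lambda>h. poly (pderiv h) c"] .
  also have "\<dots> = poly q c"
    unfolding pderiv_add pderiv_mult by (simp add: pderiv_pCons)
  finally have nd: "\<not> int l dvd poly q c"
    using simple_mod by simp
  have "ipoly g \<alpha> = 0"
    by (simp add: annihilates_iff)
  moreover have "ipoly g \<alpha> = (\<alpha> - of_int c) * ipoly q \<alpha> + of_int (poly g c)"
    by (subst q) (simp only: ipoly_add ipoly_mult ipoly_pCons ipoly_0, simp)
  ultimately have "(\<alpha> - of_int c) * ipoly q \<alpha> = - of_int (poly g c)"
    by (simp add: eq_neg_iff_add_eq_0)
  then have "\<alpha> - of_int c = - of_int (poly g c) / ipoly q \<alpha>"
    using nonzero_eq_divide_eq[OF denominator_nonzero[OF nd]] by blast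
  then show ?thesis
    using that nd by blast
qed

lemma generator_decomp:
  assumes "poly g c \<noteq> 0"
  shows "\<exists>w\<in>U. \<alpha> - of_int c = of_nat l powi int (multiplicity (int l) (poly g c)) * w"
proof -
  obtain q where q: "\<not> int l dvd poly q c" "\<alpha> - of_int c = - of_int (poly g c) / ipoly q \<alpha>"
    by (rule generator_eq)
  obtain m where m: "poly g c = int l ^ multiplicity (int l) (poly g c) * m" "\<not> int l dvd m"
    using multiplicity_decompose'[OF assms, of "int l"] l_not_unit by blast
  have "\<alpha> - of_int c = - of_int (int l ^ multiplicity (int l) (poly g c) * m) / ipoly q \<alpha>"
    using q(2) m(1) by simp
  then have "\<alpha> - of_int c
      = of_nat l powi int (multiplicity (int l) (poly g c)) * (ipoly [:- m:] \<alpha> / ipoly q \<alpha>)"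
    by (simp add: ipoly_pCons)
  moreover have "ipoly [:- m:] \<alpha> / ipoly q \<alpha> \<in> U"
    using m(2) q(1) by (intro fraction_in_U) simp_all
  ultimately show ?thesis
    by blast
qed

lemma multiple_if_dvd:
  assumes "int l dvd poly h c"
  shows "\<exists>y\<in>R. ipoly h \<alpha> = of_nat l * y"
proof -
  obtain q where q: "\<not> int l dvd poly q c" "\<alpha> - of_int c = - of_int (poly g c) / ipoly q \<alpha>"
    by (rule generator_eq)
  obtain k where k: "poly g c = int l * k"
    using root_mod by blast
  obtain k' where k': "poly h c = int l * k'"
    using assms by blast
  obtain f where f: "h = [:- c, 1:] * f + [:poly h c:]"
    by (rule divide_linear)
  have "ipoly h \<alpha> = (\<alpha> - of_int c) * ipoly f \<alpha> + of_int (poly h c)"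
    by (subst f) (simp only: ipoly_add ipoly_mult ipoly_pCons ipoly_0, simp)
  also have "\<dots> = of_nat l * (ipoly [:- k:] \<alpha> / ipoly q \<alpha> * ipoly f \<alpha> + ipoly [:k':] \<alpha>)"
    by (simp add: q(2) k k' ipoly_pCons algebra_simps)
  finally show ?thesis
  proof (rule bexI)
    show "ipoly [:- k:] \<alpha> / ipoly q \<alpha> * ipoly f \<alpha> + ipoly [:k':] \<alpha> \<in> R"
      by (intro add_mem mult_mem ipoly_mem R_I q(1))
  qed
qed

lemma in_U_or_multiple:
  assumes "x \<in> R"
  shows "x \<in> U \<or> (\<exists>y\<in>R. x = of_nat l * y)"
proof -
  obtain h s where x: "x = ipoly h \<alpha> / ipoly s \<alpha>" "\<not> int l dvd poly s c"
    using assms by (rule R_E)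
  show ?thesis
  proof (cases "int l dvd poly h c")
    case True
    then obtain y where "y \<in> R" "ipoly h \<alpha> = of_nat l * y"
      using multiple_if_dvd by blast
    moreover have "1 / ipoly s \<alpha> \<in> R"
      using R_I[OF x(2), of 1] by simp
    ultimately have "y * (1 / ipoly s \<alpha>) \<in> R" "x = of_nat l * (y * (1 / ipoly s \<alpha>))"
      using x(1) mult_mem[of y "1 / ipoly s \<alpha>"] by simp_all
    then show ?thesis
      by blast
  next
    case False
    then show ?thesis
      using x fraction_in_U by blast
  qed
qed

text \<open>
  Splitting off factors \<open>l\<close> terminates, since each of them also divides the integer \<open>m\<close>.
\<close>

lemma divisor_of_integer_valued:
  assumes "x \<in> R" "z \<in> R" "x * z = of_int m" "m \<noteq> 0"
  shows "x \<in> valued"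
  using assms
proof (induction "nat \<bar>m\<bar>" arbitrary: x m rule: less_induct)
  case less
  show ?case
  proof (cases "x \<in> U")
    case True
    then show ?thesis
      by (rule U_subset_valued)
  next
    case False
    then obtain y where y: "y \<in> R" "x = of_nat l * y"
      using in_U_or_multiple less.prems(1) by blast
    have "ipoly [:m:] \<alpha> = of_nat l * (y * z)"
      using less.prems(3) y(2) by (simp add: ipoly_pCons mult.assoc)
    then have "int l dvd poly [:m:] c"
      using mult_mem[OF y(1) less.prems(2)] by (rule dvd_if_multiple)
    then obtain m' where m': "m = int l * m'"
      by auto
    have "y * z = of_int m'"
      using less.prems(3) y(2) m' unif_nonzero by (simp add: mult.assoc)
    moreover have "m' \<noteq> 0"
      using less.prems(4) m' by simp
    moreover have "nat \<bar>m'\<bar> < nat \<bar>m\<bar>"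
      using \<open>m' \<noteq> 0\<close> prime_gt_1_nat[OF prime_l] by (simp add: m' abs_mult nat_mult_distrib)
    ultimately have "y \<in> valued"
      using less.hyps y(1) less.prems(2) by blast
    then show ?thesis
      unfolding y(2) by (intro valued_mult unif_valued)
  qed
qed

lemma ipoly_valued:
  assumes "ipoly h \<alpha> \<noteq> 0"
  shows "ipoly h \<alpha> \<in> valued"
proof -
  obtain k m where "m \<noteq> 0" "ipoly k \<alpha> * ipoly h \<alpha> = of_int m"
    using ex_multiple_constant[OF g_nonzero annihilates_iff assms] by blast
  then show ?thesis
    using divisor_of_integer_valued[of "ipoly h \<alpha>" "ipoly k \<alpha>" m] ipoly_mem by (simp add: mult.commute)
qed

lemma rat_adjoin_valued:
  assumes "x \<in> rat_adjoin \<alpha>" "x \<noteq> 0"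
  shows "x \<in> valued"
proof -
  obtain h s where "ipoly s \<alpha> \<noteq> 0" "x = ipoly h \<alpha> * inverse (ipoly s \<alpha>)"
    using rat_adjoin_fraction[OF assms(1)] by (auto simp: divide_inverse)
  then show ?thesis
    using assms(2) by (auto intro!: valued_mult valued_inverse ipoly_valued)
qed

lemma dvd_if_in_U1:
  assumes "ipoly h \<alpha> \<in> U1"
  shows "int l dvd poly h c - 1"
proof -
  obtain r where "r \<in> R" "ipoly h \<alpha> = 1 - of_nat l * r"
    using assms by (auto simp: U1_def)
  then have "int l dvd poly (h - 1) c"
    by (intro dvd_if_multiple[of "h - 1" "- r"] minus_mem) simp_all
  then show ?thesis
    by simp
qed

text \<open>
  The squared tame symbol of the valuation, with values in the nonzero elements of the ambient
  field modulo principal units, kills all relations of K2.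
\<close>

lemma K2_symbol_power_trivial_imp:
  assumes units: "a \<in> rat_adjoin \<alpha> - {0}" "b \<in> rat_adjoin \<alpha> - {0}"
    and trivial: "K2_symbol (ring_on (rat_adjoin \<alpha>)) a b [^]\<^bsub>K2 (ring_on (rat_adjoin \<alpha>))\<^esub> (n::nat)
      = \<one>\<^bsub>K2 (ring_on (rat_adjoin \<alpha>))\<^esub>"
  shows "tame_square a b ^ n \<in> U1"
proof -
  define G :: "'a monoid" where "G = \<lparr>carrier = UNIV - {0}, monoid.mult = (*), one = 1\<rparr>"
  have G: "comm_group G"
    by (rule comm_groupI) (auto simp: G_def intro!: bexI[of _ "inverse _"])
  interpret G: comm_group G
    by (rule G)
  have inv_G: "inv\<^bsub>G\<^esub> x = inverse x" if "x \<noteq> 0" for x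
    using that by (intro G.inv_equality) (simp_all add: G_def)
  have pow_G: "x [^]\<^bsub>G\<^esub> k = x ^ k" for x and k :: nat
    by (induction k) (simp_all add: G_def nat_pow_def mult.commute)
  have U1_nonzero: "x \<noteq> 0" if "x \<in> U1" for x
    using that U1_subset_U U_nonzero by blast
  have "subgroup U1 G"
  proof (rule G.subgroupI)
    show "U1 \<noteq> {}"
      using U1_one by blast
    fix x assume "x \<in> U1"
    then show "inv\<^bsub>G\<^esub> x \<in> U1"
      by (simp add: inv_G U1_nonzero U1_inverse)
  qed (use U1_nonzero U1_mult in \<open>auto simp: G_def\<close>)
  note subfield = subfield_rat_adjoin[of \<alpha>]
  have Units: "Units (ring_on (rat_adjoin \<alpha>)) = rat_adjoin \<alpha> - {0}"
    by (rule Units_ring_on(2)[OF subfield])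
  have minus: "1 \<ominus>\<^bsub>ring_on (rat_adjoin \<alpha>)\<^esub> x = 1 - x" if "x \<in> rat_adjoin \<alpha>" for x
  proof -
    have "1 \<in> rat_adjoin \<alpha>"
      using generate_field.one[of "ring_of_type_algebra :: 'a ring"]
      by (simp add: rat_adjoin_def ring_of_type_algebra_def)
    then show ?thesis
      using ring_on_minus[OF subfield _ that] by blast
  qed
  have "tame_square a b [^]\<^bsub>G\<^esub> n \<in> U1"
  proof (rule K2_symbol_detect[where t = tame_square and a = a and b = b,
        OF Units_ring_on(1)[OF subfield] G \<open>subgroup U1 G\<close>])
    show "K2_symbol (ring_on (rat_adjoin \<alpha>)) a b [^]\<^bsub>K2 (ring_on (rat_adjoin \<alpha>))\<^esub> n
      = \<one>\<^bsub>K2 (ring_on (rat_adjoin \<alpha>))\<^esub>"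
      by (rule trivial)
  qed (use units in \<open>auto simp: Units minus G_def rat_adjoin_valued tame_square_mult_left
      tame_square_mult_right tame_square_steinberg tame_square_in_U U_nonzero\<close>)
  then show ?thesis
    by (simp add: pow_G)
qed

end

section \<open>The cyclotomic element of a root of the trinomial\<close>

lemma cyclotomic_at_prime:
  assumes "Factorial_Ring.prime p"
  shows "cyclotomic_at p a = ipoly (\<Sum>i<p. Polynomial.monom 1 i) a"
  by (simp add: cyclotomic_at_def ipoly_def cyclotomic_prime[OF assms])

lemma cyclotomic_at_prime_eq:
  fixes a :: "'a::field_char_0"
  assumes "Factorial_Ring.prime p" "a \<noteq> 1"
  shows "cyclotomic_at p a = (a ^ p - 1) / (a - 1)"
proof -
  have "ipoly (\<Sum>i<n. Polynomial.monom 1 i) a = (\<Sum>i<n. a ^ i)" for n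
    by (induction n) simp_all
  then show ?thesis
    using assms geometric_sum[of a p] by (simp add: cyclotomic_at_prime)
qed

text \<open>
  A primitive cube root of unity \<open>\<omega>\<close> is not a root of \<open>X^p + X + 1\<close> when \<open>p \<equiv> 1\<close> modulo 3, since the
  value is \<open>2 \<omega> + 1\<close>.  When \<open>p \<equiv> 2\<close> it is a root, but a simple one: the derivative there
  is \<open>p \<omega> + 1\<close>.  So it is no longer a root after dividing by \<open>X\<^sup>2 + X + 1\<close>.
\<close>

lemma trinomial_quotient_root_not_cube_root_of_unity:
  fixes \<alpha> :: "'a::field_char_0"
  assumes p: "Factorial_Ring.prime p" "p > 3"
    and f1: "[p = 1] (mod 3) \<Longrightarrow> f = Polynomial.monom 1 p + [:1, 1:]"
    and f2: "[p = 2] (mod 3) \<Longrightarrow> f = (Polynomial.monom 1 p + [:1, 1:]) div [:1, 1, 1:]"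
    and root: "poly (map_poly of_rat f) \<alpha> = 0"
  shows "\<alpha> ^ p + \<alpha> + 1 = 0" "\<alpha>\<^sup>2 + \<alpha> + 1 \<noteq> 0"
proof -
  let ?T = "Polynomial.monom 1 p + [:1, 1:] :: rat poly"
  have "\<not> 3 dvd p"
    using p by (auto simp: prime_nat_iff)
  then have "p mod 3 = 1 \<or> p mod 3 = 2"
    by presburger
  then consider "[p = 1] (mod 3)" | "[p = 2] (mod 3)"
    by (auto simp: cong_def)
  then have "\<alpha> ^ p + \<alpha> + 1 = 0 \<and> \<alpha>\<^sup>2 + \<alpha> + 1 \<noteq> 0"
  proof cases
    case 1
    then have eq: "\<alpha> ^ p + \<alpha> + 1 = 0"
      using root f1 by (simp add: poly_map_poly_add of_rat_add map_poly_monom poly_monom map_poly_pCons algebra_simps)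
    have "\<alpha>\<^sup>2 + \<alpha> + 1 \<noteq> 0"
    proof
      assume *: "\<alpha>\<^sup>2 + \<alpha> + 1 = 0"
      have "\<alpha> ^ 3 - 1 = (\<alpha>\<^sup>2 + \<alpha> + 1) * (\<alpha> - 1)"
        by (simp add: power2_eq_square power3_eq_cube algebra_simps)
      then have "\<alpha> ^ 3 = 1"
        using * by simp
      moreover have "\<alpha> ^ p = (\<alpha> ^ 3) ^ (p div 3) * \<alpha> ^ (p mod 3)"
        by (simp only: power_mult[symmetric] power_add[symmetric] mult_div_mod_eq)
      ultimately have "2 * \<alpha> + 1 = 0"
        using eq 1 by (simp add: cong_def)
      moreover have "4 * (\<alpha>\<^sup>2 + \<alpha> + 1) - (2 * \<alpha> + 1)\<^sup>2 = 3"
        by (simp add: power2_eq_square algebra_simps)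
      ultimately show False
        using * by simp
    qed
    with eq show ?thesis
      by blast
  next
    case 2
    have "f * [:1, 1, 1:] = ?T"
      unfolding f2[OF 2] by (rule dvd_div_mult_self) (rule quadratic_dvd_trinomial[OF 2])
    moreover have mult: "poly (map_poly of_rat (h * k)) \<alpha>
        = poly (map_poly of_rat h) \<alpha> * poly (map_poly of_rat k) \<alpha>" for h k :: "rat poly"
      by (rule poly_map_poly_mult) (simp_all add: of_rat_add of_rat_mult)
    moreover have add: "poly (map_poly of_rat (h + k)) \<alpha>
        = poly (map_poly of_rat h) \<alpha> + poly (map_poly of_rat k) \<alpha>" for h k :: "rat poly"
      by (rule poly_map_poly_add) (simp_all add: of_rat_add)
    ultimately have "poly (map_poly of_rat ?T) \<alpha> = 0"
      using root by (metis mult_zero_left)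
    then have eq: "\<alpha> ^ p + \<alpha> + 1 = 0"
      by (simp add: add map_poly_monom poly_monom map_poly_pCons algebra_simps)
    have "\<alpha>\<^sup>2 + \<alpha> + 1 \<noteq> 0"
    proof
      assume *: "\<alpha>\<^sup>2 + \<alpha> + 1 = 0"
      have "pderiv ?T = pderiv f * [:1, 1, 1:] + f * pderiv [:1, 1, 1:]"
        unfolding \<open>f * [:1, 1, 1:] = ?T\<close>[symmetric] pderiv_mult by (simp only: mult_ac add_ac)
      then have "poly (map_poly of_rat (pderiv ?T)) \<alpha>
          = poly (map_poly of_rat (pderiv f)) \<alpha> * poly (map_poly of_rat [:1, 1, 1:]) \<alpha>"
        using root by (simp only: add mult mult_zero_left add_0_right)
      moreover have "poly (map_poly of_rat [:1, 1, 1:]) \<alpha> = 0"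
        using * by (simp add: map_poly_pCons power2_eq_square algebra_simps)
      moreover have "pderiv ?T = Polynomial.monom (of_nat p) (p - 1) + 1"
        by (simp add: pderiv_add pderiv_monom pderiv_pCons one_pCons)
      ultimately have deriv: "of_nat p * \<alpha> ^ (p - 1) + 1 = 0"
        by (simp add: add map_poly_monom poly_monom)
      have "\<alpha> ^ 3 - 1 = (\<alpha>\<^sup>2 + \<alpha> + 1) * (\<alpha> - 1)"
        by (simp add: power2_eq_square power3_eq_cube algebra_simps)
      then have cube: "\<alpha> ^ 3 = 1"
        using * by simp
      have "p = 3 * (p div 3) + 2"
        using 2 mult_div_mod_eq[of 3 p] by (simp add: cong_def)
      then have "p - 1 = 3 * (p div 3) + 1"
        by linarith
      then have "\<alpha> ^ (p - 1) = (\<alpha> ^ 3) ^ (p div 3) * \<alpha>"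
        by (simp add: power_mult)
      then have "of_nat p * \<alpha> + 1 = 0"
        using deriv by (simp add: cube)
      then have p\<alpha>: "of_nat p * \<alpha> = -1"
        by (simp only: eq_neg_iff_add_eq_0)
      have "(of_nat p)\<^sup>2 * (\<alpha>\<^sup>2 + \<alpha> + 1) = (of_nat p * \<alpha>)\<^sup>2 + of_nat p * (of_nat p * \<alpha>) + (of_nat p)\<^sup>2"
        by (simp add: power2_eq_square algebra_simps)
      also have "\<dots> = of_int (1 - int p + int p ^ 2)"
        by (simp add: p\<alpha>)
      finally have "1 - int p + int p ^ 2 = 0"
        unfolding * by (metis mult_zero_right of_int_eq_0_iff)
      then have "1 = int p * (1 - int p)"
        by (simp add: power2_eq_square algebra_simps)
      then have "int p dvd 1"
        by (rule dvdI)
      then show False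
        using p by simp
    qed
    with eq show ?thesis
      by blast
  qed
  then show "\<alpha> ^ p + \<alpha> + 1 = 0" "\<alpha>\<^sup>2 + \<alpha> + 1 \<noteq> 0"
    by blast+
qed

lemma trinomial_root_nondegenerate:
  fixes \<alpha> :: "'a::field_char_0"
  assumes p: "odd p" and root: "\<alpha> ^ p + \<alpha> + 1 = 0"
  shows "\<alpha> \<noteq> 0" "\<alpha> \<noteq> 1" "\<alpha> + 2 \<noteq> 0"
proof -
  have "p > 0"
    using p by (cases p) auto
  then show "\<alpha> \<noteq> 0"
    using root by (auto simp: zero_power)
  show "\<alpha> \<noteq> 1"
    using root by auto
  show "\<alpha> + 2 \<noteq> 0"
  proof
    assume "\<alpha> + 2 = 0"
    then have "\<alpha> = - 2"
      by (simp add: eq_neg_iff_add_eq_0)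
    have "of_nat (2 ^ p + 1) = - (\<alpha> ^ p + \<alpha> + 1)"
      unfolding \<open>\<alpha> = - 2\<close> using p by simp
    then have "of_nat (2 ^ p + 1) = (0 :: 'a)"
      by (simp only: root minus_zero)
    then show False
      by (simp only: of_nat_eq_0_iff)
  qed
qed

text \<open>
  The squared tame symbol of the cube is \<open>\<alpha>^(6 e)\<close>, with residue \<open>(-2)^(6 e)\<close>; if it were
  principal, then \<open>p\<close>, the order of \<open>4\<close> modulo \<open>l\<close>, would divide \<open>3 e\<close>.
\<close>

lemma K2_symbol_cube_nontrivial:
  fixes \<alpha> :: "'a::field_char_0"
  assumes p: "Factorial_Ring.prime p" "p > 3"
    and root: "\<alpha> ^ p + \<alpha> + 1 = 0" and not_cyc: "\<alpha>\<^sup>2 + \<alpha> + 1 \<noteq> 0"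
  defines "F \<equiv> rat_adjoin \<alpha>"
  defines "b \<equiv> (\<alpha> + 2) / (1 - \<alpha>)"
  assumes b: "b \<in> F"
  shows "K2_symbol (ring_on F) \<alpha> b [^]\<^bsub>K2 (ring_on F)\<^esub> (3::nat) \<noteq> \<one>\<^bsub>K2 (ring_on F)\<^esub>"
proof
  assume trivial: "K2_symbol (ring_on F) \<alpha> b [^]\<^bsub>K2 (ring_on F)\<^esub> (3::nat) = \<one>\<^bsub>K2 (ring_on F)\<^esub>"
  have odd: "odd p"
    using p by (auto simp: prime_odd_nat)
  note nondeg = trinomial_root_nondegenerate[OF odd root]
  have T0: "ipoly (trinomial p) \<alpha> = 0"
    using root by (simp add: ipoly_pCons algebra_simps)
  have "degree (trinomial p) = p"
    using p by (subst degree_add_eq_left) (simp_all add: degree_monom_eq)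
  then have "lead_coeff (trinomial p) = 1"
    using p by (simp add: coeff_pCons split: nat.split)
  then obtain g where g: "lead_coeff g = 1" "\<And>h. ipoly h \<alpha> = 0 \<longleftrightarrow> g dvd h"
    using ex_monic_min_poly[OF T0] by blast
  have g0: "ipoly g \<alpha> = 0"
    using g(2) by simp
  obtain k where k: "trinomial p = g * k"
    using g(2) T0 unfolding dvd_def by blast
  have "degree g > 0"
  proof (rule ccontr)
    assume "\<not> degree g > 0"
    then obtain c where "g = [:c:]"
      by (metis degree_eq_zeroE gr0I)
    then show False
      using g(1) g0 by (simp add: ipoly_pCons)
  qed
  moreover have "g \<noteq> [:1, 1, 1:]"
    using g0 not_cyc by (auto simp: ipoly_pCons power2_eq_square algebra_simps)
  ultimately have gt3: "\<bar>poly g (-2)\<bar> > 3"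
    using factor_value_gt_3[OF odd _ g(1)] k by simp
  define N where "N = nat \<bar>poly g (-2)\<bar>"
  have "poly g (-2) dvd poly (trinomial p) (-2)"
    by (simp add: k)
  also have "poly (trinomial p) (-2) = - int (2 ^ p + 1)"
    using odd by (simp add: poly_monom)
  finally have "int N dvd int (2 ^ p + 1)"
    unfolding N_def by (simp only: dvd_minus_iff int_nat_eq abs_ge_zero if_True abs_dvd_iff)
  then have N: "N dvd 2 ^ p + 1" "N > 3"
    using gt3 by (simp_all only: int_dvd_int_iff) (simp add: N_def)
  obtain l where l: "Factorial_Ring.prime l" "l \<noteq> 3" "\<not> p dvd multiplicity l N"
    using ex_prime_multiplicity_not_dvd[OF p N] by blast
  define e where "e = multiplicity l N"
  have "l dvd N"
    using l(3) not_dvd_imp_multiplicity_0 by fastforce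
  then have l': "l dvd 2 ^ p + 1"
    using N(1) dvd_trans by blast
  have l_g: "int l dvd poly g (-2)"
    using \<open>l dvd N\<close> int_dvd_int_iff[of l N] by (simp add: N_def)
  interpret simple_root_mod_prime \<alpha> g l "-2"
  proof
    show "Factorial_Ring.prime l" "int l dvd poly g (-2)" "g \<noteq> 0"
      using l(1) l_g gt3 by auto
    show "ipoly h \<alpha> = 0 \<longleftrightarrow> g dvd h" for h
      by (rule g(2))
    show "\<not> int l dvd poly (pderiv g) (-2)"
      using trinomial_simple_root[OF p l(1,2) l'] l_g unfolding k by (auto simp: pderiv_mult)
  qed
  have "odd l"
    using l' p by (metis dvd_add_right_iff dvd_power dvd_trans odd_one prime_gt_0_nat)
  \<comment> \<open>The residues of \<open>\<alpha>\<close> and \<open>1 - \<alpha>\<close> are \<open>-2\<close> and \<open>3\<close>.\<close>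
  have not_dvd: "\<not> int l dvd poly [:0, 1:] (-2)" "\<not> int l dvd poly [:1, -1:] (-2)"
  proof -
    have "\<not> l dvd 2" "\<not> l dvd 3"
      using l(1,2) \<open>odd l\<close> primes_dvd_imp_eq[of l 2] primes_dvd_imp_eq[of l 3] by auto
    then show "\<not> int l dvd poly [:0, 1:] (-2)" "\<not> int l dvd poly [:1, -1:] (-2)"
      using int_dvd_int_iff[of l 2] int_dvd_int_iff[of l 3] by simp_all
  qed
  have \<alpha>_U: "\<alpha> \<in> U" and \<alpha>1_U: "1 - \<alpha> \<in> U"
    using not_dvd[THEN ipoly_in_U] by (simp_all add: ipoly_pCons)
  obtain w where w: "w \<in> U" "\<alpha> + 2 = of_nat l powi int e * w"
  proof -
    have "poly g (-2) \<noteq> 0"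
      using gt3 by auto
    then show ?thesis
      using generator_decomp that by (auto simp: e_def N_def multiplicity_int_nat_abs)
  qed
  have b_eq: "b = of_nat l powi int e * (w * inverse (1 - \<alpha>))"
    by (simp add: b_def w(2) divide_inverse)
  have "val b = int e"
    using val_eqI(1)[OF b_eq] w(1) \<alpha>1_U by (simp add: U_mult U_inverse)
  moreover have "val \<alpha> = 0" "unit_part \<alpha> = \<alpha>"
    using val_eqI[of \<alpha> 0 \<alpha>] \<alpha>_U by simp_all
  ultimately have "tame_square \<alpha> b = (\<alpha> ^ e)\<^sup>2"
    by (simp add: tame_square_def)
  moreover have "tame_square \<alpha> b ^ 3 \<in> U1"
  proof (rule K2_symbol_power_trivial_imp)
    show "\<alpha> \<in> rat_adjoin \<alpha> - {0}"
      using ipoly_in_rat_adjoin[of "[:0, 1:]" \<alpha>] nondeg by (simp add: ipoly_pCons)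
    show "b \<in> rat_adjoin \<alpha> - {0}"
      using b nondeg by (simp add: F_def b_def)
  qed (use trivial in \<open>simp add: F_def\<close>)
  ultimately have "ipoly (Polynomial.monom 1 (2 * (3 * e))) \<alpha> \<in> U1"
    by (simp add: mult_ac flip: power_mult)
  then have "int l dvd (-2) ^ (2 * (3 * e)) - 1"
    using dvd_if_in_U1 by (fastforce simp: poly_monom)
  then have "p dvd 3 * e"
    by (rule order_minus_two(1)[OF p(1) l(1,2) l'])
  then have "p dvd e"
    using p by (auto simp: prime_dvd_mult_iff dest: dvd_imp_le)
  then show False
    using l(3) by (simp add: e_def)
qed

theorem theorem9p3:
  fixes p :: nat and f :: "rat poly" and \<alpha> :: "'a::field_char_0" and F :: "'a set"
  assumes "Factorial_Ring.prime p" and "p > 3"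
    and "[p = 1] (mod 3) \<Longrightarrow> f = Polynomial.monom 1 p + [:1, 1:]"
    and "[p = 2] (mod 3) \<Longrightarrow> f = (Polynomial.monom 1 p + [:1, 1:]) div [:1, 1, 1:]"
    and "poly (map_poly of_rat f) \<alpha> = 0"
    and "F = rat_adjoin \<alpha>"
  shows "\<alpha> \<noteq> 0 \<and> cyclotomic_at p \<alpha> \<noteq> 0 \<and> cyclotomic_at p (\<alpha> ^ 3) \<noteq> 0
    \<and> \<one>\<^bsub>K2 (ring_on F)\<^esub> \<noteq> cyclotomic_elem p F \<alpha> [^]\<^bsub>K2 (ring_on F)\<^esub> (3::nat)
    \<and> cyclotomic_elem p F \<alpha> [^]\<^bsub>K2 (ring_on F)\<^esub> (3::nat) = cyclotomic_elem p F (\<alpha> ^ 3)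
    \<and> cyclotomic_elem p F (\<alpha> ^ 3) \<in> cyclotomic_elems p F"
proof -
  note p = assms(1,2)
  note root = trinomial_quotient_root_not_cube_root_of_unity[OF assms(1-5)]
  have odd: "odd p"
    using p by (auto simp: prime_odd_nat)
  note nondeg = trinomial_root_nondegenerate[OF odd root(1)]
  have \<alpha>p: "\<alpha> ^ p = - \<alpha> - 1"
    using root(1) by (simp add: algebra_simps eq_neg_iff_add_eq_0)
  have \<alpha>3: "\<alpha> ^ 3 - 1 = (\<alpha> - 1) * (\<alpha>\<^sup>2 + \<alpha> + 1)"
    by (simp add: power2_eq_square power3_eq_cube algebra_simps)
  have \<alpha>3_ne: "\<alpha> ^ 3 \<noteq> 1"
    using \<alpha>3 nondeg root(2) by auto
  have c1: "cyclotomic_at p \<alpha> = (\<alpha> + 2) / (1 - \<alpha>)"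
  proof -
    have "cyclotomic_at p \<alpha> = (- (\<alpha> + 2)) / (- (1 - \<alpha>))"
      using cyclotomic_at_prime_eq[OF p(1) nondeg(2)] by (simp add: \<alpha>p)
    then show ?thesis
      by (simp only: minus_divide_divide)
  qed
  have c3: "cyclotomic_at p (\<alpha> ^ 3) = cyclotomic_at p \<alpha>"
  proof -
    have "(\<alpha> ^ 3) ^ p - 1 = (- \<alpha> - 1) ^ 3 - 1"
      by (metis \<alpha>p power_commutes power_mult mult.commute)
    also have "\<dots> = (- \<alpha> - 1 - 1) * (\<alpha>\<^sup>2 + \<alpha> + 1)"
      by (simp add: power2_eq_square power3_eq_cube algebra_simps)
    finally show ?thesis
      using cyclotomic_at_prime_eq[OF p(1) nondeg(2)] cyclotomic_at_prime_eq[OF p(1) \<alpha>3_ne] root(2)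
      by (simp add: \<alpha>3 \<alpha>p)
  qed
  have nonzero: "cyclotomic_at p \<alpha> \<noteq> 0"
    using c1 nondeg by simp
  have mem: "\<alpha> \<in> F" "cyclotomic_at p \<alpha> \<in> F" "\<alpha> ^ 3 \<in> F"
    using ipoly_in_rat_adjoin[of "[:0, 1:]" \<alpha>] ipoly_in_rat_adjoin[of _ \<alpha>] ipoly_in_rat_adjoin[of "Polynomial.monom 1 3" \<alpha>]
    by (simp_all add: assms(6) ipoly_pCons cyclotomic_at_prime[OF p(1)])
  have Units: "Units (ring_on F) = F - {0}" and ring: "ring (ring_on F)"
    unfolding assms(6) by (intro Units_ring_on subfield_rat_adjoin)+
  have "cyclotomic_elem p F \<alpha> [^]\<^bsub>K2 (ring_on F)\<^esub> (3::nat) = cyclotomic_elem p F (\<alpha> ^ 3)"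
    using K2_symbol_cube_left[OF ring, of \<alpha> "cyclotomic_at p \<alpha>"] nondeg(1) nonzero mem
    unfolding cyclotomic_elem_def c3 by (simp add: Units power3_eq_cube)
  moreover have "\<one>\<^bsub>K2 (ring_on F)\<^esub> \<noteq> cyclotomic_elem p F \<alpha> [^]\<^bsub>K2 (ring_on F)\<^esub> (3::nat)"
    using K2_symbol_cube_nontrivial[OF p root] mem(2)
    by (simp add: cyclotomic_elem_def c1 assms(6))
  moreover have "cyclotomic_elem p F (\<alpha> ^ 3) \<in> cyclotomic_elems p F"
    unfolding cyclotomic_elems_def using mem nonzero nondeg(1) c3 by auto
  ultimately show ?thesis
    using nonzero nondeg(1) c3 by simp
qed

end
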